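(* Let $G$ be a connected $4$-regular graph. Then $G$ is not $(3,1)$-colorable if and only if $G$ can be constructed from odd double cycles via a sequence of edge adhesions, i.e., $G$ belongs to the smallest class $\mathcal{C}$ of graphs that contains every odd double cycle and such that whenever $G_1,G_2\in\mathcal{C}$ are vertex-disjoint and $e_1\in E(G_1)$, $e_2\in E(G_2)$, also $(G_1,e_1)+(G_2,e_2)\in\mathcal{C}$.
   Context: All graphs are finite, undirected pseudographs: multiple edges and loops are allowed, and a loop contributes $2$ to the degree of its vertex. An $(r-t,t)$-coloring of an $r$-regular graph is an edge-coloring using at least two colors such that every vertex is incident to exactly $r-t$ edges of one color and exactly $t$ edges of a different color. Edge adhesion: for vertex-disjoint graphs $G_1,G_2$ and edges $e_1=u_1v_1\in E(G_1)$, $e_2=u_2v_2\in E(G_2)$, the graph $(G_1,e_1)+(G_2,e_2)$ has vertex set $V(G_1)\cup V(G_2)\cup\{w\}$ ($w$ a new vertex) and edge set $(E(G_1)\setminus\{e_1\})\cup(E(G_2)\setminus\{e_2\})\cup\{u_1w,v_1w,u_2w,v_2w\}$ (i.e., subdivide $e_1$ and $e_2$ and identify the two subdivision vertices). A double cycle on $n\ge 1$ vertices is obtained from a cycle on $n$ vertices by doubling each edge: for $n\ge3$ this is $C_n$ with every edge replaced by two parallel edges; for $n=2$ it is two vertices joined by four parallel edges; for $n=1$ it is one vertex with two loops. It is odd (even) if $n$ is odd (even). *)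

theory Defs
  imports Main "HOL-Library.Uprod"
begin

text \<open>
  Undirected pseudographs with named edges: parallel edges are distinct edges with the same
  unordered pair of ends, and a loop at \<open>v\<close> is an edge with ends \<open>Upair v v\<close>.
\<close>

record ('v, 'e) pgraph =
  verts :: "'v set"
  edges :: "'e set"
  ends :: "'e \<Rightarrow> 'v uprod"

definition finite_pgraph :: "('v, 'e) pgraph \<Rightarrow> bool" where
  "finite_pgraph G \<longleftrightarrow>
     finite (verts G) \<and> finite (edges G) \<and> (\<forall>e\<in>edges G. set_uprod (ends G e) \<subseteq> verts G)"

definition adj_rel :: "('v, 'e) pgraph \<Rightarrow> ('v \<times> 'v) set" where
  "adj_rel G = {(u, v). \<exists>e\<in>edges G. ends G e = Upair u v}"

definition connected_pgraph :: "('v, 'e) pgraph \<Rightarrow> bool" where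
  "connected_pgraph G \<longleftrightarrow>
     verts G \<noteq> {} \<and> (\<forall>u\<in>verts G. \<forall>v\<in>verts G. (u, v) \<in> (adj_rel G)\<^sup>*)"

text \<open>
  The number of incidences of \<open>v\<close> with edges in \<open>F\<close>. The second summand makes a loop count twice,
  both for the degree and for the number of edges of a given colour at a vertex.
\<close>

definition degree_in :: "('v, 'e) pgraph \<Rightarrow> 'e set \<Rightarrow> 'v \<Rightarrow> nat" where
  "degree_in G F v =
     card {e \<in> F. v \<in> set_uprod (ends G e)} + card {e \<in> F. ends G e = Upair v v}"

definition regular_pgraph :: "nat \<Rightarrow> ('v, 'e) pgraph \<Rightarrow> bool" where
  "regular_pgraph r G \<longleftrightarrow> (\<forall>v\<in>verts G. degree_in G (edges G) v = r)"

definition color_degree :: "('v, 'e) pgraph \<Rightarrow> ('e \<Rightarrow> 'c) \<Rightarrow> 'c \<Rightarrow> 'v \<Rightarrow> nat" where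
  "color_degree G c a v = degree_in G {e \<in> edges G. c e = a} v"

text \<open>
  A \<open>(p, q)\<close>-coloring of a \<open>(p + q)\<close>-regular graph. The two colors at a vertex may depend on
  the vertex.
\<close>

definition is_coloring :: "nat \<Rightarrow> nat \<Rightarrow> ('v, 'e) pgraph \<Rightarrow> ('e \<Rightarrow> 'c) \<Rightarrow> bool" where
  "is_coloring p q G c \<longleftrightarrow>
     (\<exists>e\<in>edges G. \<exists>f\<in>edges G. c e \<noteq> c f) \<and>
     (\<forall>v\<in>verts G. \<exists>a b. a \<noteq> b \<and> color_degree G c a v = p \<and> color_degree G c b v = q)"

text \<open>The number of colors is not bounded; for finite graphs colors can be taken in \<open>nat\<close>.\<close>

definition colorable :: "nat \<Rightarrow> nat \<Rightarrow> ('v, 'e) pgraph \<Rightarrow> bool" where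
  "colorable p q G \<longleftrightarrow> (\<exists>c :: 'e \<Rightarrow> nat. is_coloring p q G c)"

text \<open>
  The vertices are \<open>x 0, \<dots>, x (n - 1)\<close>, and \<open>d (i, False)\<close>, \<open>d (i, True)\<close> are the two
  edges between \<open>x i\<close> and its cyclic successor. For \<open>n = 2\<close> this gives four
  parallel edges, for \<open>n = 1\<close> two loops.
\<close>

definition double_cycle :: "nat \<Rightarrow> ('v, 'e) pgraph \<Rightarrow> bool" where
  "double_cycle n G \<longleftrightarrow> n \<ge> 1 \<and>
     (\<exists>(x :: nat \<Rightarrow> 'v) (d :: nat \<times> bool \<Rightarrow> 'e).
        bij_betw x {..<n} (verts G) \<and>
        bij_betw d ({..<n} \<times> UNIV) (edges G) \<and>
        (\<forall>i<n. \<forall>b. ends G (d (i, b)) = Upair (x i) (x ((i + 1) mod n))))"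

text \<open>
  \<open>H\<close> is \<open>(G1, e1) + (G2, e2)\<close>, for some choice of the new vertex \<open>w\<close> and of names
  \<open>f1, f2, f3, f4\<close> for the four new edges. The names only have to differ from the edges that
  are kept, so the names of the deleted edges may be reused.
\<close>

definition edge_adhesion ::
  "('v, 'e) pgraph \<Rightarrow> 'e \<Rightarrow> ('v, 'e) pgraph \<Rightarrow> 'e \<Rightarrow> ('v, 'e) pgraph \<Rightarrow> bool" where
  "edge_adhesion G1 e1 G2 e2 H \<longleftrightarrow>
     verts G1 \<inter> verts G2 = {} \<and> edges G1 \<inter> edges G2 = {} \<and>
     e1 \<in> edges G1 \<and> e2 \<in> edges G2 \<and>
     (\<exists>u1 v1 u2 v2 w f1 f2 f3 f4.
        ends G1 e1 = Upair u1 v1 \<and> ends G2 e2 = Upair u2 v2 \<and>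
        w \<notin> verts G1 \<union> verts G2 \<and>
        distinct [f1, f2, f3, f4] \<and>
        {f1, f2, f3, f4} \<inter> ((edges G1 - {e1}) \<union> (edges G2 - {e2})) = {} \<and>
        verts H = verts G1 \<union> verts G2 \<union> {w} \<and>
        edges H = (edges G1 - {e1}) \<union> (edges G2 - {e2}) \<union> {f1, f2, f3, f4} \<and>
        (\<forall>e\<in>edges G1 - {e1}. ends H e = ends G1 e) \<and>
        (\<forall>e\<in>edges G2 - {e2}. ends H e = ends G2 e) \<and>
        ends H f1 = Upair u1 w \<and> ends H f2 = Upair v1 w \<and>
        ends H f3 = Upair u2 w \<and> ends H f4 = Upair v2 w)"

inductive adhesion_class :: "('v, 'e) pgraph \<Rightarrow> bool" where
  odd_double_cycle: "odd n \<Longrightarrow> double_cycle n G \<Longrightarrow> adhesion_class G"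
| adhesion: "adhesion_class G1 \<Longrightarrow> adhesion_class G2 \<Longrightarrow> edge_adhesion G1 e1 G2 e2 H \<Longrightarrow>
    adhesion_class H"

end

theory Submission
  imports Defs
begin

text \<open>
  If the order is even, a connected graph has a subgraph with all degrees odd, and this subgraph and
  its complement are the two color classes. So let the order be odd.

  Suppose that the edges leaving a vertex set \<open>S\<close> are exactly two, both to one vertex \<open>w\<close>, and let \<open>R\<close>
  be the set of the remaining vertices. If \<open>card S\<close> is odd, then so is \<open>card R\<close>, and \<open>G\<close> is an adhesion
  at \<open>w\<close> of graphs on \<open>S\<close> and \<open>R\<close>. By parity, \<open>R \<union> {w}\<close> has a two-coloring in which the two edges
  from \<open>w\<close> to \<open>R\<close> differ; it extends any coloring of the graph on \<open>S\<close>. Hence neither part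
  is colorable, and induction applies.

  All other colorings come from one construction. Let \<open>f\<close> be the only edge between \<open>v\<close> and \<open>x\<close>. Color
  \<open>f\<close> with 0, the other edges at \<open>x\<close> with 1, the other edges at \<open>v\<close> with 2, and the rest with 1 and 2 such
  that color 2 has odd degree at each further vertex. This is possible iff every union \<open>D\<close> of
  components of \<open>G - v - x\<close> has as many vertices as edges to \<open>v\<close>, modulo 2. If there are sets \<open>S\<close> as
  above but only of even order, take a smallest one, \<open>v = w\<close>, and a neighbor \<open>x \<in> S\<close> of \<open>w\<close>. If there are
  none, then no vertex separates the graph, and a vertex \<open>v\<close> with a simple edge has a simple edge to some
  \<open>x\<close> such that \<open>G - v - x\<close> is connected. The construction fails only if there are no
  simple edges at all, which means that \<open>G\<close> is a double cycle.
\<close>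

section \<open>Incidences and edges between vertex sets\<close>

definition incidence :: "('v, 'e) pgraph \<Rightarrow> 'e \<Rightarrow> 'v \<Rightarrow> nat" where
  "incidence G e v = of_bool (v \<in> set_uprod (ends G e)) + of_bool (ends G e = Upair v v)"

text \<open>The two sets need not be disjoint: \<open>between G Z Z\<close> holds the edges of the
  subgraph induced by \<open>Z\<close>, and \<open>between G {w} {w}\<close> the loops at
  \<open>w\<close>. A subset \<open>D\<close> of \<open>Z\<close> is a union of components of that
  subgraph iff \<open>between G D (Z - D)\<close> is empty; components appear in this form
  throughout, and such sets are called closed.\<close>

definition between :: "('v, 'e) pgraph \<Rightarrow> 'v set \<Rightarrow> 'v set \<Rightarrow> 'e set" where
  "between G A B = {e \<in> edges G. \<exists>a\<in>A. \<exists>b\<in>B. ends G e = Upair a b}"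

lemma incidence_Upair:
  "ends G e = Upair p q \<Longrightarrow> incidence G e v = of_bool (p = v) + of_bool (q = v)"
  by (auto simp: incidence_def)

lemma incidence_eq_0_iff: "incidence G e v = 0 \<longleftrightarrow> v \<notin> set_uprod (ends G e)"
  by (auto simp: incidence_def)

lemma degree_in_eq_sum:
  assumes "finite F"
  shows "degree_in G F v = (\<Sum>e\<in>F. incidence G e v)"
proof -
  have "(\<Sum>e\<in>F. incidence G e v) =
      (\<Sum>e\<in>F. of_bool (v \<in> set_uprod (ends G e))) + (\<Sum>e\<in>F. of_bool (ends G e = Upair v v))"
    by (simp add: incidence_def sum.distrib)
  then show ?thesis
    using assms by (simp add: degree_in_def sum_of_bool_eq Int_def conj_commute)
qed

lemma degree_in_Un_disjoint:
  assumes "finite A" "finite B" "A \<inter> B = {}"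
  shows "degree_in G (A \<union> B) v = degree_in G A v + degree_in G B v"
  using assms by (simp add: degree_in_eq_sum sum.union_disjoint)

lemma degree_in_cong_incident:
  assumes "finite A" "finite B"
    and "\<And>e. incidence G e v \<noteq> 0 \<Longrightarrow> e \<in> A \<longleftrightarrow> e \<in> B"
  shows "degree_in G A v = degree_in G B v"
proof -
  have "degree_in G A v = (\<Sum>e\<in>A \<inter> B. incidence G e v)"
    unfolding degree_in_eq_sum[OF assms(1)] using assms by (intro sum.mono_neutral_right) auto
  moreover have "degree_in G B v = (\<Sum>e\<in>A \<inter> B. incidence G e v)"
    unfolding degree_in_eq_sum[OF assms(2)] using assms by (intro sum.mono_neutral_right) auto
  ultimately show ?thesis by simp
qed

lemma between_Un_left: "between G (A \<union> B) C = between G A C \<union> between G B C"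
  by (auto simp: between_def)

lemma between_commute: "between G A B = between G B A"
  by (auto simp: between_def) (metis Upair_inject)+

lemma between_mono: "A \<subseteq> A' \<Longrightarrow> B \<subseteq> B' \<Longrightarrow> between G A B \<subseteq> between G A' B'"
  by (auto simp: between_def)

lemma finite_between: "finite_pgraph G \<Longrightarrow> finite (between G A B)"
  by (auto simp: between_def finite_pgraph_def)

lemma between_subset_edges: "between G A B \<subseteq> edges G"
  by (auto simp: between_def)

lemma ends_in_verts:
  assumes "finite_pgraph G" "e \<in> edges G" "ends G e = Upair p q"
  shows "p \<in> verts G" "q \<in> verts G"
  using assms by (fastforce simp: finite_pgraph_def)+

lemma card_between_Un_left:
  assumes "finite_pgraph G" "A \<inter> B = {}" "w \<notin> A" "w \<notin> B"
  shows "card (between G (A \<union> B) {w}) = card (between G A {w}) + card (between G B {w})"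
proof -
  have "between G A {w} \<inter> between G B {w} = {}"
    using assms by (auto simp: between_def)
  then show ?thesis
    by (simp add: between_Un_left card_Un_disjoint finite_between assms)
qed

lemma degree_in_between:
  assumes "finite_pgraph G" "v \<notin> A" "z \<in> A"
  shows "degree_in G (between G A {v}) z = card (between G {z} {v})"
proof -
  have "{e \<in> between G A {v}. z \<in> set_uprod (ends G e)} = between G {z} {v}"
    using assms by (auto simp: between_def)
  moreover have "{e \<in> between G A {v}. ends G e = Upair z z} = {}"
    using assms by (auto simp: between_def)
  ultimately show ?thesis unfolding degree_in_def by (metis add_0_right card.empty)
qed

lemma card_between_sum:
  assumes "finite_pgraph G" "finite D" "w \<notin> D"
  shows "card (between G D {w}) = (\<Sum>z\<in>D. card (between G {z} {w}))"
  using assms(2,3)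
proof (induction D rule: finite_induct)
  case empty
  then show ?case by (simp add: between_def)
next
  case (insert x D)
  then show ?case
    using card_between_Un_left[OF assms(1), of "{x}" D w] by simp
qed

text \<open>Double counting: an edge contributes to the degree sum over \<open>D\<close> the number
  of its ends in \<open>D\<close>, which is odd exactly for the edges that leave
  \<open>D\<close>.\<close>

lemma parity_degree_sum:
  assumes "finite_pgraph G" "D \<subseteq> verts G"
  shows "even (\<Sum>v\<in>D. degree_in G (edges G) v) \<longleftrightarrow> even (card (between G D (verts G - D)))"
proof -
  have fin: "finite D" "finite (edges G)"
    using assms by (auto simp: finite_pgraph_def finite_subset)
  have *: "odd (\<Sum>v\<in>D. incidence G e v) \<longleftrightarrow> e \<in> between G D (verts G - D)" if e: "e \<in> edges G" for e
  proof -
    obtain p q where pq: "ends G e = Upair p q" by (cases "ends G e")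
    have pqV: "p \<in> verts G" "q \<in> verts G"
      using ends_in_verts[OF assms(1) e pq] by auto
    have "(\<Sum>v\<in>D. incidence G e v) = (\<Sum>v\<in>D. of_bool (p = v)) + (\<Sum>v\<in>D. of_bool (q = v))"
      by (simp add: incidence_Upair[OF pq] sum.distrib)
    also have "\<dots> = of_bool (p \<in> D) + of_bool (q \<in> D)"
      using fin by (simp add: of_bool_def sum.delta)
    finally show ?thesis
      using pqV e by (auto simp: between_def pq)
  qed
  have "(\<Sum>v\<in>D. degree_in G (edges G) v) = (\<Sum>e\<in>edges G. \<Sum>v\<in>D. incidence G e v)"
    unfolding degree_in_eq_sum[OF fin(2)] by (rule sum.swap)
  moreover have "{e \<in> edges G. odd (\<Sum>v\<in>D. incidence G e v)} = between G D (verts G - D)"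
    using * by (auto simp: between_def)
  ultimately show ?thesis
    using fin by (simp add: even_sum_iff)
qed

section \<open>Connectedness by closed vertex sets\<close>

lemma connected_pgraphI:
  assumes "finite_pgraph G" "verts G \<noteq> {}"
    and "\<And>D. D \<subseteq> verts G \<Longrightarrow> D \<noteq> {} \<Longrightarrow> between G D (verts G - D) = {} \<Longrightarrow> D = verts G"
  shows "connected_pgraph G"
  unfolding connected_pgraph_def
proof (intro conjI ballI)
  fix u v assume u: "u \<in> verts G" and v: "v \<in> verts G"
  \<comment> \<open>No edge leaves the set of vertices reachable from \<open>u\<close>, so the third
    assumption applies to it.\<close>
  define D where "D = {z \<in> verts G. (u, z) \<in> (adj_rel G)\<^sup>*}"
  have "between G D (verts G - D) = {}"
  proof (rule ccontr)
    assume "between G D (verts G - D) \<noteq> {}"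
    then obtain e a b where "e \<in> edges G" "a \<in> D" "b \<in> verts G - D" "ends G e = Upair a b"
      by (auto simp: between_def)
    then have "(a, b) \<in> adj_rel G" "(u, a) \<in> (adj_rel G)\<^sup>*" "b \<in> verts G" "b \<notin> D"
      by (auto simp: adj_rel_def D_def)
    then show False by (auto simp: D_def intro: rtrancl_into_rtrancl)
  qed
  moreover have "u \<in> D" "D \<subseteq> verts G" using u by (auto simp: D_def)
  ultimately have "D = verts G" using assms(3)[of D] by blast
  then show "(u, v) \<in> (adj_rel G)\<^sup>*" using v by (auto simp: D_def)
qed (use assms in auto)

lemma connected_pgraph_between:
  assumes "connected_pgraph G" "D \<subseteq> verts G" "D \<noteq> {}" "D \<noteq> verts G" "finite_pgraph G"
  shows "between G D (verts G - D) \<noteq> {}"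
proof
  assume none: "between G D (verts G - D) = {}"
  obtain u v where u: "u \<in> D" and v: "v \<in> verts G" "v \<notin> D" using assms by auto
  have "(u, v) \<in> (adj_rel G)\<^sup>*" using assms u v by (auto simp: connected_pgraph_def)
  then have "v \<in> D"
  proof (induction rule: rtrancl_induct)
    case base
    then show ?case using u .
  next
    case (step y z)
    then obtain e where e: "e \<in> edges G" "ends G e = Upair y z" by (auto simp: adj_rel_def)
    then have "z \<in> verts G" using ends_in_verts(2)[OF assms(5)] by blast
    then show ?case using none step e by (auto simp: between_def)
  qed
  then show False using v by simp
qed

subsection \<open>Joins\<close>

text \<open>The edges of a walk from \<open>s\<close> to \<open>t\<close> are added to
  \<open>J\<close> modulo 2, one by one; at each stage only \<open>s\<close> and the current end
  have changed parity. An edge used repeatedly is toggled repeatedly, so the walk need not be a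
  path.\<close>

lemma toggle_path:
  assumes "finite_pgraph G" "B \<subseteq> edges G"
    and "(s, t) \<in> {(a, b). \<exists>e\<in>B. ends G e = Upair a b}\<^sup>*"
    and "J \<subseteq> B"
  obtains J' where "J' \<subseteq> B"
    "\<And>y. odd (degree_in G J' y) \<longleftrightarrow> (odd (degree_in G J y) \<noteq> ((y = s) \<noteq> (y = t)))"
proof -
  have finB: "finite B"
    using assms by (auto simp: finite_pgraph_def intro: finite_subset)
  have "\<exists>J' \<subseteq> B. \<forall>y. odd (degree_in G J' y) \<longleftrightarrow> (odd (degree_in G J y) \<noteq> ((y = s) \<noteq> (y = t)))"
    using assms(3)
  proof (induction rule: rtrancl_induct)
    case base
    then show ?case using assms(4) by auto
  next
    case (step p q)
    then obtain J' e where J': "J' \<subseteq> B"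
      "\<And>y. odd (degree_in G J' y) \<longleftrightarrow> (odd (degree_in G J y) \<noteq> ((y = s) \<noteq> (y = p)))"
      and e: "e \<in> B" "ends G e = Upair p q" by auto
    have fin: "finite J'" using finB J' by (auto intro: finite_subset)
    define J'' where "J'' = (if e \<in> J' then J' - {e} else insert e J')"
    have "odd (degree_in G J'' y) \<longleftrightarrow> (odd (degree_in G J' y) \<noteq> odd (incidence G e y))" for y
    proof (cases "e \<in> J'")
      case True
      then have "degree_in G J' y = incidence G e y + degree_in G J'' y"
        using fin by (simp add: J''_def degree_in_eq_sum sum.remove)
      then show ?thesis by auto
    next
      case False
      then have "degree_in G J'' y = incidence G e y + degree_in G J' y"
        using fin by (simp add: J''_def degree_in_eq_sum)
      then show ?thesis by auto
    qed
    moreover have "odd (incidence G e y) \<longleftrightarrow> ((y = p) \<noteq> (y = q))" for y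
      by (auto simp: incidence_Upair[OF e(2)])
    moreover have "J'' \<subseteq> B" using J' e by (auto simp: J''_def)
    ultimately show ?case using J'(2) by (intro exI[of _ J'']) auto
  qed
  then show ?thesis using that by blast
qed

text \<open>The existence of \<open>T\<close>-joins in the subgraph induced by \<open>Z\<close>. By
  induction on \<open>card T\<close>: two vertices of \<open>T\<close> in one component are dropped,
  and a join for the remaining ones is toggled along a walk between the two.\<close>

lemma join_exists:
  assumes "finite_pgraph G" "Z \<subseteq> verts G" "T \<subseteq> Z"
    and "\<And>D. D \<subseteq> Z \<Longrightarrow> between G D (Z - D) = {} \<Longrightarrow> even (card (D \<inter> T))"
  shows "\<exists>J \<subseteq> between G Z Z. \<forall>z\<in>Z. odd (degree_in G J z) \<longleftrightarrow> z \<in> T"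
  using assms(3,4)
proof (induction "card T" arbitrary: T rule: less_induct)
  case less
  have finT: "finite T"
    using less.prems(1) assms by (auto simp: finite_pgraph_def intro: finite_subset)
  show ?case
  proof (cases "T = {}")
    case True
    then show ?thesis by (intro exI[of _ "{}"]) (auto simp: degree_in_def)
  next
    case False
    then obtain t where t: "t \<in> T" by auto
    define r where "r = {(a, b). \<exists>e\<in>between G Z Z. ends G e = Upair a b}"
    \<comment> \<open>The component of \<open>t\<close> in the subgraph induced by
      \<open>Z\<close>.\<close>
    define D where "D = {z. (t, z) \<in> r\<^sup>*}"
    have "D \<subseteq> Z"
    proof
      fix z assume "z \<in> D"
      then have "(t, z) \<in> r\<^sup>*" by (simp add: D_def)
      then show "z \<in> Z"
        by (induction rule: rtrancl_induct) (use t less.prems(1) in \<open>auto simp: r_def between_def\<close>)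
    qed
    moreover have "between G D (Z - D) = {}"
    proof (rule ccontr)
      assume "between G D (Z - D) \<noteq> {}"
      then obtain e a b where ab: "e \<in> edges G" "a \<in> D" "b \<in> Z - D" "ends G e = Upair a b"
        by (auto simp: between_def)
      then have "(a, b) \<in> r" using \<open>D \<subseteq> Z\<close> by (auto simp: r_def between_def)
      then have "b \<in> D" using ab by (auto simp: D_def intro: rtrancl_into_rtrancl)
      then show False using ab by auto
    qed
    ultimately have "even (card (D \<inter> T))" using less.prems(2) by blast
    moreover have tD: "t \<in> D \<inter> T" using t by (auto simp: D_def)
    ultimately have "D \<inter> T \<noteq> {t}" by auto
    then obtain t' where t': "t' \<in> D" "t' \<in> T" "t' \<noteq> t" using tD by auto
    have tt': "(t, t') \<in> r\<^sup>*" using t' by (simp add: D_def)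
    define T' where "T' = T - {t, t'}"
    have "\<exists>J \<subseteq> between G Z Z. \<forall>z\<in>Z. odd (degree_in G J z) \<longleftrightarrow> z \<in> T'"
    proof (rule less.hyps)
      show "card T' < card T" using finT t by (auto simp: T'_def intro!: psubset_card_mono)
      show "T' \<subseteq> Z" using less.prems(1) by (auto simp: T'_def)
      fix E assume E: "E \<subseteq> Z" "between G E (Z - E) = {}"
      \<comment> \<open>A closed set contains both or neither of \<open>t\<close> and
        \<open>t'\<close>, since a walk inside \<open>Z\<close> joins them; so removing them from
        \<open>T\<close> preserves the parity condition.\<close>
      have step: "b \<in> E \<longleftrightarrow> a \<in> E" if "(a, b) \<in> r" for a b
        using that E by (auto simp: r_def between_def) (metis Upair_inject DiffI)+
      have "t' \<in> E \<longleftrightarrow> t \<in> E"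
        using tt' by (induction rule: rtrancl_induct) (auto simp: step)
      then have "card (E \<inter> T) = card (E \<inter> T') + (if t \<in> E then 2 else 0)"
      proof (cases "t \<in> E")
        case True
        then have "E \<inter> T = insert t (insert t' (E \<inter> T'))"
          using \<open>t' \<in> E \<longleftrightarrow> t \<in> E\<close> t t' by (auto simp: T'_def)
        then show ?thesis using True t' finT by (simp add: T'_def)
      next
        case False
        then have "E \<inter> T = E \<inter> T'"
          using \<open>t' \<in> E \<longleftrightarrow> t \<in> E\<close> by (auto simp: T'_def)
        then show ?thesis using False by simp
      qed
      then show "even (card (E \<inter> T'))" using less.prems(2)[OF E] by (auto split: if_splits)
    qed
    then obtain J where J: "J \<subseteq> between G Z Z" "\<And>z. z \<in> Z \<Longrightarrow> odd (degree_in G J z) \<longleftrightarrow> z \<in> T'"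
      by blast
    obtain J' where "J' \<subseteq> between G Z Z"
      "\<And>y. odd (degree_in G J' y) \<longleftrightarrow> (odd (degree_in G J y) \<noteq> ((y = t) \<noteq> (y = t')))"
      using toggle_path[OF assms(1) between_subset_edges tt'[unfolded r_def] J(1)] by blast
    then show ?thesis
      using J t t' by (intro exI[of _ J']) (auto simp: T'_def)
  qed
qed

subsection \<open>Colorings\<close>

text \<open>Any single vertex already sees two different colors, which yields the global requirement
  that two colors occur.\<close>

lemma is_coloringI:
  assumes "verts G \<noteq> {}"
    and "\<And>v. v \<in> verts G \<Longrightarrow> \<exists>a b. a \<noteq> b \<and> color_degree G c a v = 3 \<and> color_degree G c b v = 1"
  shows "is_coloring 3 1 G c"
proof -
  obtain v where "v \<in> verts G" using assms by auto
  then obtain a b where ab: "a \<noteq> b" "color_degree G c a v = 3" "color_degree G c b v = 1"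
    using assms(2) by blast
  have "\<exists>e\<in>edges G. c e = k" if "color_degree G c k v \<noteq> 0" for k
  proof (rule ccontr)
    assume "\<not> (\<exists>e\<in>edges G. c e = k)"
    then have none: "{e \<in> edges G. c e = k} = {}" by auto
    show False using that unfolding color_degree_def none by (simp add: degree_in_def)
  qed
  from this[of a] this[of b] have "\<exists>e\<in>edges G. \<exists>f\<in>edges G. c e \<noteq> c f" using ab by auto
  then show ?thesis using assms by (auto simp: is_coloring_def)
qed

text \<open>The two color degrees add up to 4, so oddness of one of them forces 1 and 3. This turns
  the search for colorings into a search for joins.\<close>

lemma two_colors_odd:
  assumes "finite_pgraph G" "degree_in G (edges G) v = 4" "a \<noteq> b"
    and "\<And>e. e \<in> edges G \<Longrightarrow> v \<in> set_uprod (ends G e) \<Longrightarrow> c e = a \<or> c e = b"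
    and "odd (color_degree G c a v)"
  shows "\<exists>a b. a \<noteq> b \<and> color_degree G c a v = 3 \<and> color_degree G c b v = 1"
proof -
  have fin: "finite (edges G)" using assms by (simp add: finite_pgraph_def)
  have "degree_in G (edges G) v = degree_in G ({e \<in> edges G. c e = a} \<union> {e \<in> edges G. c e = b}) v"
    using fin assms(4) by (intro degree_in_cong_incident) (auto simp: incidence_eq_0_iff)
  also have "\<dots> = color_degree G c a v + color_degree G c b v"
    unfolding color_degree_def using fin assms(3) by (intro degree_in_Un_disjoint) auto
  finally have sum4: "color_degree G c a v + color_degree G c b v = 4" using assms by simp
  have odd_le_4: "x = 1 \<or> x = 3" if "x + y = 4" "odd x" for x y :: nat
    using that by presburger
  from sum4 have "color_degree G c a v = 1 \<or> color_degree G c a v = 3"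
    using assms(5) odd_le_4 by blast
  then show ?thesis
  proof
    assume "color_degree G c a v = 1"
    then have "color_degree G c b v = 3" using sum4 by simp
    then show ?thesis using \<open>color_degree G c a v = 1\<close> assms(3)
      by - (rule exI[of _ b], rule exI[of _ a], simp)
  next
    assume "color_degree G c a v = 3"
    then have "color_degree G c b v = 1" using sum4 by simp
    then show ?thesis using \<open>color_degree G c a v = 3\<close> assms(3)
      by - (rule exI[of _ a], rule exI[of _ b], simp)
  qed
qed

section \<open>Members of the adhesion class are not colorable\<close>

lemma finite_pgraph_double_cycle:
  assumes "double_cycle n G"
  shows "finite_pgraph G"
proof -
  obtain x :: "nat \<Rightarrow> 'a" and d :: "nat \<times> bool \<Rightarrow> 'b" where n: "n \<ge> 1"
    and x: "bij_betw x {..<n} (verts G)" and d: "bij_betw d ({..<n} \<times> UNIV) (edges G)"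
    and ends: "\<And>i b. i < n \<Longrightarrow> ends G (d (i, b)) = Upair (x i) (x ((i + 1) mod n))"
    using assms unfolding double_cycle_def by blast
  have "finite (verts G)" "finite (edges G)"
    using bij_betw_finite[OF x] bij_betw_finite[OF d] by auto
  moreover have "set_uprod (ends G e) \<subseteq> verts G" if "e \<in> edges G" for e
  proof -
    have "e \<in> d ` ({..<n} \<times> UNIV)" using that bij_betw_imp_surj_on[OF d] by simp
    then obtain i b where "i < n" "e = d (i, b)" by auto
    then show ?thesis using n ends bij_betw_imp_surj_on[OF x] by auto
  qed
  ultimately show ?thesis by (auto simp: finite_pgraph_def)
qed

lemma edge_adhesionE:
  assumes "edge_adhesion G1 e1 G2 e2 H"
  obtains u1 v1 u2 v2 w f1 f2 f3 f4 where
    "verts G1 \<inter> verts G2 = {}" "edges G1 \<inter> edges G2 = {}"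
    "e1 \<in> edges G1" "e2 \<in> edges G2" "ends G1 e1 = Upair u1 v1" "ends G2 e2 = Upair u2 v2"
    "w \<notin> verts G1 \<union> verts G2" "distinct [f1, f2, f3, f4]"
    "{f1, f2, f3, f4} \<inter> ((edges G1 - {e1}) \<union> (edges G2 - {e2})) = {}"
    "verts H = verts G1 \<union> verts G2 \<union> {w}"
    "edges H = (edges G1 - {e1}) \<union> (edges G2 - {e2}) \<union> {f1, f2, f3, f4}"
    "\<forall>e\<in>edges G1 - {e1}. ends H e = ends G1 e" "\<forall>e\<in>edges G2 - {e2}. ends H e = ends G2 e"
    "ends H f1 = Upair u1 w" "ends H f2 = Upair v1 w"
    "ends H f3 = Upair u2 w" "ends H f4 = Upair v2 w"
  using assms unfolding edge_adhesion_def by (elim conjE exE) (rule that; assumption)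

lemma finite_pgraph_adhesion_class: "adhesion_class G \<Longrightarrow> finite_pgraph G"
proof (induction rule: adhesion_class.induct)
  case (odd_double_cycle n G)
  then show ?case using finite_pgraph_double_cycle by blast
next
  case (adhesion G1 G2 e1 e2 H)
  obtain u1 v1 u2 v2 w f1 f2 f3 f4 where
    disj: "verts G1 \<inter> verts G2 = {}" "edges G1 \<inter> edges G2 = {}"
    and e: "e1 \<in> edges G1" "e2 \<in> edges G2" "ends G1 e1 = Upair u1 v1" "ends G2 e2 = Upair u2 v2"
    and w: "w \<notin> verts G1 \<union> verts G2" and dist: "distinct [f1, f2, f3, f4]"
    and new: "{f1, f2, f3, f4} \<inter> ((edges G1 - {e1}) \<union> (edges G2 - {e2})) = {}"
    and VH: "verts H = verts G1 \<union> verts G2 \<union> {w}"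
    and EH: "edges H = (edges G1 - {e1}) \<union> (edges G2 - {e2}) \<union> {f1, f2, f3, f4}"
    and kept: "\<forall>e\<in>edges G1 - {e1}. ends H e = ends G1 e" "\<forall>e\<in>edges G2 - {e2}. ends H e = ends G2 e"
    and f: "ends H f1 = Upair u1 w" "ends H f2 = Upair v1 w"
       "ends H f3 = Upair u2 w" "ends H f4 = Upair v2 w"
    by (rule edge_adhesionE[OF adhesion.hyps(3)])
  have uv: "u1 \<in> verts G1" "v1 \<in> verts G1" "u2 \<in> verts G2" "v2 \<in> verts G2"
    using ends_in_verts[OF adhesion.IH(1) e(1,3)] ends_in_verts[OF adhesion.IH(2) e(2,4)] by auto
  have "set_uprod (ends H g) \<subseteq> verts H" if g: "g \<in> edges H" for g
  proof -
    consider "g \<in> edges G1 - {e1}" | "g \<in> edges G2 - {e2}" | "g \<in> {f1, f2, f3, f4}"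
      using g EH by blast
    then show ?thesis
    proof cases
      case 1
      then show ?thesis using adhesion.IH(1) VH kept(1) by (auto simp: finite_pgraph_def)
    next
      case 2
      then show ?thesis using adhesion.IH(2) VH kept(2) by (auto simp: finite_pgraph_def)
    next
      case 3
      moreover have "\<forall>g\<in>{f1, f2, f3, f4}. set_uprod (ends H g) \<subseteq> verts H"
        using uv VH f by simp
      ultimately show ?thesis by blast
    qed
  qed
  then show ?case using adhesion.IH VH EH by (simp add: finite_pgraph_def)
qed

text \<open>Four edge slots at a vertex come in two pairs. The slot with the minority color makes
  its own pair bichromatic and leaves the other pair monochromatic.\<close>

lemma three_one_split:
  fixes p q r s a b :: 'c
  assumes "a \<noteq> b"
    and "of_bool (p = a) + of_bool (q = a) + of_bool (r = a) + of_bool (s = a) = (3 :: nat)"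
    and "of_bool (p = b) + of_bool (q = b) + of_bool (r = b) + of_bool (s = b) = (1 :: nat)"
  shows "p = q \<longleftrightarrow> r \<noteq> s"
  using assms by (cases "p = a"; cases "q = a"; cases "r = a"; cases "s = a") auto

text \<open>At every vertex exactly one of the pairs of parallel edges before and after it is
  bichromatic, so bichromatic and monochromatic pairs alternate around the cycle. This is impossible
  for odd length.\<close>

lemma not_colorable_odd_double_cycle:
  assumes "odd n" "double_cycle n G"
  shows "\<not> is_coloring 3 1 G c"
proof
  assume col: "is_coloring 3 1 G c"
  obtain x :: "nat \<Rightarrow> 'a" and d :: "nat \<times> bool \<Rightarrow> 'b" where n: "n \<ge> 1"
    and x: "bij_betw x {..<n} (verts G)" and d: "bij_betw d ({..<n} \<times> UNIV) (edges G)"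
    and ends: "\<And>i b. i < n \<Longrightarrow> ends G (d (i, b)) = Upair (x i) (x ((i + 1) mod n))"
    using assms unfolding double_cycle_def by blast
  have fin: "finite (edges G)" using finite_pgraph_double_cycle[OF assms(2)] by (simp add: finite_pgraph_def)
  define bi where "bi i \<longleftrightarrow> c (d (i, False)) \<noteq> c (d (i, True))" for i
  \<comment> \<open>Here \<open>i\<close> is the predecessor of \<open>j\<close>. For
    \<open>n = 1\<close> both are 0, and the formula counts each loop twice, as required.\<close>
  have deg: "color_degree G c a (x j) =
      of_bool (c (d (j, False)) = a) + of_bool (c (d (j, True)) = a) +
      of_bool (c (d (i, False)) = a) + of_bool (c (d (i, True)) = a)"
    if ij: "i < n" "j = (i + 1) mod n" for a i j
  proof -
    have j: "j < n" using n ij by simp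
    have inc: "incidence G (d (k, b)) (x j) = of_bool (k = j) + of_bool (k = i)" if k: "k < n" for k b
    proof -
      have inj: "x k' = x j \<longleftrightarrow> k' = j" if "k' < n" for k'
        using bij_betw_imp_inj_on[OF x] that j by (auto simp: inj_on_def)
      have "(k + 1) mod n < n" using n by simp
      moreover have "(k + 1) mod n = j \<longleftrightarrow> k = i"
        using k ij by (auto simp: mod_Suc split: if_splits)
      ultimately show ?thesis
        using incidence_Upair[OF ends[OF k, of b], of "x j"] inj k by simp
    qed
    have "color_degree G c a (x j) = (\<Sum>e\<in>edges G. of_bool (c e = a) * incidence G e (x j))"
      unfolding color_degree_def using fin
      by (auto simp: degree_in_eq_sum sum.inter_filter of_bool_def intro!: sum.cong)
    also have "\<dots> = (\<Sum>p\<in>{..<n} \<times> UNIV. of_bool (c (d p) = a) * incidence G (d p) (x j))"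
      by (rule sum.reindex_bij_betw[OF d, symmetric])
    also have "\<dots> = (\<Sum>(k, b)\<in>{..<n} \<times> UNIV. of_bool (c (d (k, b)) = a) * (of_bool (k = j) + of_bool (k = i)))"
      by (rule sum.cong[OF refl]) (auto simp: inc)
    also have "\<dots> = (\<Sum>k<n. \<Sum>b\<in>UNIV. of_bool (c (d (k, b)) = a) * (of_bool (k = j) + of_bool (k = i)))"
      by (rule sum.cartesian_product[symmetric])
    also have "\<dots> = (\<Sum>k<n. if k = j then of_bool (c (d (k, False)) = a) + of_bool (c (d (k, True)) = a) else 0) +
        (\<Sum>k<n. if k = i then of_bool (c (d (k, False)) = a) + of_bool (c (d (k, True)) = a) else 0)"
      unfolding sum.distrib[symmetric] by (intro sum.cong) (auto simp: UNIV_bool)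
    also have "\<dots> = of_bool (c (d (j, False)) = a) + of_bool (c (d (j, True)) = a) +
      of_bool (c (d (i, False)) = a) + of_bool (c (d (i, True)) = a)"
      using ij j by simp
    finally show ?thesis .
  qed
  have step: "bi ((i + 1) mod n) \<longleftrightarrow> \<not> bi i" if i: "i < n" for i
  proof -
    let ?j = "(i + 1) mod n"
    have "x ?j \<in> verts G" using bij_betw_imp_surj_on[OF x] n by auto
    then obtain a b where "a \<noteq> b" "color_degree G c a (x ?j) = 3" "color_degree G c b (x ?j) = 1"
      using col by (auto simp: is_coloring_def)
    then show ?thesis
      using three_one_split[of a b "c (d (?j, False))" "c (d (?j, True))" "c (d (i, False))" "c (d (i, True))"]
        deg[OF i refl] by (auto simp: bi_def)
  qed
  have "bi i \<longleftrightarrow> (bi 0 \<noteq> odd i)" if "i < n" for i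
    using that
  proof (induction i)
    case (Suc i)
    then show ?case using step[of i] by simp
  qed simp
  \<comment> \<open>Since \<open>n - 1\<close> is even, pair \<open>n - 1\<close> is of the same
    kind as pair 0, although the two are consecutive.\<close>
  from this[of "n - 1"] have "bi (n - 1) \<longleftrightarrow> bi 0" using n assms(1) by simp
  moreover have "bi 0 \<longleftrightarrow> \<not> bi (n - 1)" using step[of "n - 1"] n by simp
  ultimately show False by simp
qed

text \<open>In \<open>H\<close>, the edge \<open>e1\<close> is subdivided by \<open>w\<close> into
  \<open>f1\<close> and \<open>f2\<close>, and every edge of \<open>H\<close> at \<open>z\<close>
  stems from \<open>G1\<close>. If both halves take the color of \<open>e1\<close>, no color degree
  at \<open>z\<close> changes: away from \<open>w\<close>, the incidences of the halves add up to
  those of \<open>e1\<close>, also if \<open>e1\<close> is a loop.\<close>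

lemma color_degree_suppress:
  assumes fin: "finite_pgraph G1" "finite_pgraph H"
    and e1: "e1 \<in> edges G1" "ends G1 e1 = Upair u v"
    and f: "f1 \<noteq> f2" "{f1, f2} \<inter> (edges G1 - {e1}) = {}" "{f1, f2} \<subseteq> edges H"
       "ends H f1 = Upair u w" "ends H f2 = Upair v w" "w \<noteq> z"
    and kept: "\<And>e. e \<in> edges G1 - {e1} \<Longrightarrow> e \<in> edges H \<and> ends H e = ends G1 e \<and> c e = c1 e"
    and only: "\<And>e. e \<in> edges H \<Longrightarrow> z \<in> set_uprod (ends H e) \<Longrightarrow> e \<in> edges G1 - {e1} \<or> e \<in> {f1, f2}"
    and c: "c f1 = c1 e1" "c f2 = c1 e1"
  shows "color_degree G1 c1 a z = color_degree H c a z"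
proof -
  define E where "E = {e \<in> edges G1 - {e1}. c1 e = a}"
  have finE: "finite E" "finite (edges G1)" "finite (edges H)"
    using fin by (auto simp: E_def finite_pgraph_def)
  have E: "degree_in G1 E z = degree_in H E z"
    unfolding degree_in_eq_sum[OF finE(1)]
  proof (rule sum.cong)
    fix e assume "e \<in> E"
    then have "ends H e = ends G1 e" using kept[of e] by (simp add: E_def)
    then show "incidence G1 e z = incidence H e z" by (simp add: incidence_def)
  qed simp
  have "color_degree H c a z = degree_in H (E \<union> {e \<in> {f1, f2}. c e = a}) z"
    unfolding color_degree_def
  proof (rule degree_in_cong_incident)
    fix e assume "incidence H e z \<noteq> 0"
    then have "e \<in> edges H \<Longrightarrow> e \<in> edges G1 - {e1} \<or> e \<in> {f1, f2}"
      using only[of e] by (simp add: incidence_eq_0_iff)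
    then show "e \<in> {e \<in> edges H. c e = a} \<longleftrightarrow> e \<in> E \<union> {e \<in> {f1, f2}. c e = a}"
      using kept[of e] f(3) unfolding E_def by auto
  qed (use finE in auto)
  also have "\<dots> = degree_in H E z + degree_in H {e \<in> {f1, f2}. c e = a} z"
    by (rule degree_in_Un_disjoint) (use finE f(2) in \<open>auto simp: E_def\<close>)
  finally have H: "color_degree H c a z = degree_in H E z + degree_in H {e \<in> {f1, f2}. c e = a} z" .
  have "color_degree G1 c1 a z = degree_in G1 (E \<union> {e \<in> {e1}. c1 e = a}) z"
    unfolding color_degree_def
    by (rule arg_cong[where f = "\<lambda>F. degree_in G1 F z"]) (use e1 in \<open>auto simp: E_def\<close>)
  also have "\<dots> = degree_in G1 E z + degree_in G1 {e \<in> {e1}. c1 e = a} z"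
    by (rule degree_in_Un_disjoint) (use finE in \<open>auto simp: E_def\<close>)
  also have "degree_in G1 {e \<in> {e1}. c1 e = a} z = degree_in H {e \<in> {f1, f2}. c e = a} z"
  proof (cases "c1 e1 = a")
    case True
    then have "{e \<in> {e1}. c1 e = a} = {e1}" "{e \<in> {f1, f2}. c e = a} = {f1, f2}"
      using c by auto
    then show ?thesis
      using f by (simp add: degree_in_eq_sum incidence_Upair[OF e1(2)]
          incidence_Upair[OF f(4)] incidence_Upair[OF f(5)])
  next
    case False
    then have "{e \<in> {e1}. c1 e = a} = {}" "{e \<in> {f1, f2}. c e = a} = {}"
      using c by auto
    then show ?thesis by (metis degree_in_eq_sum finite.emptyI sum.empty)
  qed
  finally show ?thesis using H E by simp
qed

text \<open>In a coloring of \<open>H\<close>, one of the pairs \<open>f1\<close>, \<open>f2\<close>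
  and \<open>f3\<close>, \<open>f4\<close> at \<open>w\<close> is monochromatic. Undoing the
  subdivision on that side and giving its color to the deleted edge yields a coloring of
  \<open>G1\<close> or \<open>G2\<close>.\<close>

lemma not_colorable_adhesion:
  assumes fin: "finite_pgraph G1" "finite_pgraph G2"
    and nc: "\<And>c :: 'e \<Rightarrow> 'c. \<not> is_coloring 3 1 G1 c" "\<And>c :: 'e \<Rightarrow> 'c. \<not> is_coloring 3 1 G2 c"
    and adh: "edge_adhesion G1 e1 G2 e2 (H :: ('v, 'e) pgraph)" and finH: "finite_pgraph H"
  shows "\<not> is_coloring 3 1 H (c :: 'e \<Rightarrow> 'c)"
proof
  assume col: "is_coloring 3 1 H c"
  obtain u1 v1 u2 v2 w f1 f2 f3 f4 where
    disj: "verts G1 \<inter> verts G2 = {}" "edges G1 \<inter> edges G2 = {}"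
    and e: "e1 \<in> edges G1" "e2 \<in> edges G2" "ends G1 e1 = Upair u1 v1" "ends G2 e2 = Upair u2 v2"
    and w: "w \<notin> verts G1 \<union> verts G2" and dist: "distinct [f1, f2, f3, f4]"
    and new: "{f1, f2, f3, f4} \<inter> ((edges G1 - {e1}) \<union> (edges G2 - {e2})) = {}"
    and VH: "verts H = verts G1 \<union> verts G2 \<union> {w}"
    and EH: "edges H = (edges G1 - {e1}) \<union> (edges G2 - {e2}) \<union> {f1, f2, f3, f4}"
    and kept: "\<forall>e\<in>edges G1 - {e1}. ends H e = ends G1 e" "\<forall>e\<in>edges G2 - {e2}. ends H e = ends G2 e"
    and f: "ends H f1 = Upair u1 w" "ends H f2 = Upair v1 w"
       "ends H f3 = Upair u2 w" "ends H f4 = Upair v2 w"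
    by (rule edge_adhesionE[OF adh])
  have uv: "u1 \<in> verts G1" "v1 \<in> verts G1" "u2 \<in> verts G2" "v2 \<in> verts G2"
    using ends_in_verts[OF fin(1) e(1,3)] ends_in_verts[OF fin(2) e(2,4)] by auto
  have in1: "set_uprod (ends H e) \<subseteq> verts G1" if "e \<in> edges G1 - {e1}" for e
    using kept(1) that fin(1) by (auto simp: finite_pgraph_def)
  have in2: "set_uprod (ends H e) \<subseteq> verts G2" if "e \<in> edges G2 - {e2}" for e
    using kept(2) that fin(2) by (auto simp: finite_pgraph_def)
  have colH: "\<exists>a b. a \<noteq> b \<and> color_degree H c a z = 3 \<and> color_degree H c b z = 1" if "z \<in> verts H" for z
    using col that by (auto simp: is_coloring_def)
  have finHE: "finite (edges H)" using finH by (simp add: finite_pgraph_def)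
  have degw: "color_degree H c a w =
      of_bool (c f1 = a) + of_bool (c f2 = a) + of_bool (c f3 = a) + of_bool (c f4 = a)" for a
  proof -
    have "color_degree H c a w = (\<Sum>e\<in>edges H. of_bool (c e = a) * incidence H e w)"
      unfolding color_degree_def using finHE
      by (auto simp: degree_in_eq_sum sum.inter_filter of_bool_def intro!: sum.cong)
    also have "\<dots> = (\<Sum>e\<in>{f1, f2, f3, f4}. of_bool (c e = a) * incidence H e w)"
    proof (rule sum.mono_neutral_right[OF finHE])
      show "\<forall>e\<in>edges H - {f1, f2, f3, f4}. of_bool (c e = a) * incidence H e w = 0"
      proof
        fix e assume "e \<in> edges H - {f1, f2, f3, f4}"
        then have "w \<notin> set_uprod (ends H e)" using EH in1[of e] in2[of e] w by blast
        then show "of_bool (c e = a) * incidence H e w = 0" by (simp add: incidence_eq_0_iff)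
      qed
    qed (use EH in auto)
    also have "\<dots> = of_bool (c f1 = a) + of_bool (c f2 = a) + of_bool (c f3 = a) + of_bool (c f4 = a)"
      using dist uv w by (auto simp: incidence_Upair[OF f(1)] incidence_Upair[OF f(2)]
          incidence_Upair[OF f(3)] incidence_Upair[OF f(4)])
    finally show ?thesis .
  qed
  obtain a b where ab: "a \<noteq> b" "color_degree H c a w = 3" "color_degree H c b w = 1"
    using colH[of w] VH by auto
  have "c f1 = c f2 \<or> c f3 = c f4"
    using three_one_split[OF ab(1), of "c f1" "c f2" "c f3" "c f4"] ab degw by auto
  then show False
  proof
    assume mono: "c f1 = c f2"
    have "color_degree G1 (c(e1 := c f1)) a z = color_degree H c a z" if z: "z \<in> verts G1" for a z
    proof (rule color_degree_suppress[OF fin(1) finH e(1) e(3)])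
      show "e \<in> edges H \<and> ends H e = ends G1 e \<and> c e = (c(e1 := c f1)) e" if "e \<in> edges G1 - {e1}" for e
        using that kept(1) EH by simp
      show "ends H f1 = Upair u1 w" "ends H f2 = Upair v1 w" using f by auto
      fix e assume "e \<in> edges H" "z \<in> set_uprod (ends H e)"
      then show "e \<in> edges G1 - {e1} \<or> e \<in> {f1, f2}"
        using EH in2[of e] z disj(1) w uv f by auto
    qed (use dist new EH w z mono in auto)
    then have "is_coloring 3 1 G1 (c(e1 := c f1))"
      using colH VH uv by (intro is_coloringI) auto
    then show False using nc by blast
  next
    assume mono: "c f3 = c f4"
    have "color_degree G2 (c(e2 := c f3)) a z = color_degree H c a z" if z: "z \<in> verts G2" for a z
    proof (rule color_degree_suppress[OF fin(2) finH e(2) e(4)])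
      show "e \<in> edges H \<and> ends H e = ends G2 e \<and> c e = (c(e2 := c f3)) e" if "e \<in> edges G2 - {e2}" for e
        using that kept(2) EH by simp
      show "ends H f3 = Upair u2 w" "ends H f4 = Upair v2 w" using f by auto
      fix e assume "e \<in> edges H" "z \<in> set_uprod (ends H e)"
      then show "e \<in> edges G2 - {e2} \<or> e \<in> {f3, f4}"
        using EH in1[of e] z disj(1) w uv f by auto
    qed (use dist new EH w z mono in auto)
    then have "is_coloring 3 1 G2 (c(e2 := c f3))"
      using colH VH uv by (intro is_coloringI) auto
    then show False using nc by blast
  qed
qed

lemma not_colorable_adhesion_class:
  assumes "adhesion_class G"
  shows "\<not> is_coloring 3 1 G c"
  using assms
proof (induction arbitrary: c rule: adhesion_class.induct)
  case (odd_double_cycle n G)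
  then show ?case by (rule not_colorable_odd_double_cycle)
next
  case (adhesion G1 G2 e1 e2 H)
  then have "finite_pgraph G1" "finite_pgraph G2" "finite_pgraph H"
    using finite_pgraph_adhesion_class adhesion_class.adhesion[OF adhesion.hyps] by auto
  then show ?case by (intro not_colorable_adhesion[OF _ _ adhesion.IH adhesion.hyps(3)])
qed

text \<open>A walk that never turns back must repeat a vertex; since every vertex has only two
  neighbors, the first repetition is a return to the start. The cycle need not cover
  \<open>V\<close>, only a component of the graph given by \<open>N\<close>.\<close>

lemma two_regular_cycle:
  fixes N :: "'v \<Rightarrow> 'v set"
  assumes "finite V" "V \<noteq> {}"
    and N: "\<And>v. v \<in> V \<Longrightarrow> N v \<subseteq> V \<and> card (N v) = 2 \<and> v \<notin> N v"
    and symN: "\<And>u v. u \<in> N v \<Longrightarrow> v \<in> N u"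
  obtains x :: "nat \<Rightarrow> 'v" and n :: nat where "n \<ge> 3" "inj_on x {..<n}" "x ` {..<n} \<subseteq> V"
    "\<And>i. i < n \<Longrightarrow> \<exists>k<n. (k + 1) mod n = i \<and> N (x i) = {x k, x ((i + 1) mod n)}"
proof -
  have pair: "N v = {a, b}" if "v \<in> V" "a \<in> N v" "b \<in> N v" "a \<noteq> b" for v a b
  proof (rule sym[OF card_subset_eq])
    show "finite (N v)" using N[OF that(1)] by (intro card_ge_0_finite) simp
  qed (use N[OF that(1)] that in auto)
  \<comment> \<open>A state of the walk is the pair of the current and the next vertex, so that not
    turning back is a condition on successive states.\<close>
  have "\<exists>s. \<forall>n. (fst (s n) \<in> V \<and> snd (s n) \<in> N (fst (s n))) \<and>
      (fst (s (Suc n)) = snd (s n) \<and> snd (s (Suc n)) \<noteq> fst (s n))"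
  proof (rule dependent_nat_choice)
    obtain v where v: "v \<in> V" using assms by auto
    then have "N v \<noteq> {}" using N[OF v] by auto
    then obtain u where "u \<in> N v" by auto
    then show "\<exists>p. fst p \<in> V \<and> snd p \<in> N (fst p)" using v by (intro exI[of _ "(v, u)"]) simp
  next
    fix p :: "'v \<times> 'v"
    assume p: "fst p \<in> V \<and> snd p \<in> N (fst p)"
    then have c: "snd p \<in> V" using N[of "fst p"] by auto
    then have "\<not> N (snd p) \<subseteq> {fst p}"
      using N[OF c] card_mono[of "{fst p}" "N (snd p)"] by auto
    then obtain q where "q \<in> N (snd p)" "q \<noteq> fst p" by auto
    then show "\<exists>q. (fst q \<in> V \<and> snd q \<in> N (fst q)) \<and> fst q = snd p \<and> snd q \<noteq> fst p"
      using c by (intro exI[of _ "(snd p, q)"]) simp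
  qed
  then obtain s where s: "\<And>n. fst (s n) \<in> V" "\<And>n. snd (s n) \<in> N (fst (s n))"
    "\<And>n. fst (s (Suc n)) = snd (s n)" "\<And>n. snd (s (Suc n)) \<noteq> fst (s n)" by blast
  define x where "x i = fst (s i)" for i
  have xV: "x i \<in> V" for i using s by (simp add: x_def)
  have step: "x (Suc i) \<in> N (x i)" for i using s(2,3) by (simp add: x_def)
  have turn: "x (Suc (Suc i)) \<noteq> x i" for i using s(3,4) by (simp add: x_def)
  have nbrs: "N (x (Suc i)) = {x i, x (Suc (Suc i))}" for i
    using turn[of i] step by (intro pair[OF xV]) (auto intro: symN)
  define P where "P n \<longleftrightarrow> (\<exists>j<n. x j = x n)" for n
  have "\<exists>n. P n"
  proof (rule ccontr)
    assume none: "\<not> (\<exists>n. P n)"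
    have "inj x"
    proof (rule injI, rule ccontr)
      fix i j assume "x i = x j" "i \<noteq> j"
      then show False using none by (cases "i < j") (auto simp: P_def, metis linorder_neqE_nat)
    qed
    moreover have "finite (range x)" using xV assms(1) by (auto intro: finite_subset)
    ultimately show False using finite_imageD by blast
  qed
  \<comment> \<open>The time of the first repetition; the vertices before it are distinct.\<close>
  define n where "n = (LEAST n. P n)"
  have "P n" unfolding n_def using \<open>\<exists>n. P n\<close> by (rule LeastI_ex)
  then obtain j where j: "j < n" "x j = x n" by (auto simp: P_def)
  have least: "\<not> P m" if "m < n" for m using that not_less_Least unfolding n_def by blast
  have inj: "inj_on x {..<n}"
  proof (rule inj_onI)
    fix a b assume ab: "a \<in> {..<n}" "b \<in> {..<n}" "x a = x b"
    show "a = b"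
    proof (rule linorder_cases)
      assume "a < b" then show ?thesis using least[of b] ab by (auto simp: P_def)
    next
      assume "b < a" then show ?thesis using least[of a] ab by (auto simp: P_def)
    qed
  qed
  then have injD: "a = b" if "x a = x b" "a < n" "b < n" for a b
    using that by (auto dest: inj_onD)
  obtain m where m: "n = Suc m" using j by (cases n) auto
  have "x m \<in> N (x j)" using step[of m] j m symN by simp
  \<comment> \<open>For \<open>j > 0\<close>, \<open>x m\<close> is a neighbor of
    \<open>x j\<close>, hence its predecessor or its successor on the walk. The former contradicts
    injectivity, the latter makes the walk turn back or a vertex its own neighbor.\<close>
  have "j = 0"
  proof (rule ccontr)
    assume "j \<noteq> 0"
    then obtain i where i: "j = Suc i" by (cases j) auto
    have "x m = x i \<or> x m = x (Suc j)" using \<open>x m \<in> N (x j)\<close> nbrs[of i] i by simp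
    then show False
    proof
      assume "x m = x i"
      then show False using injD[of m i] i j m by simp
    next
      assume eq: "x m = x (Suc j)"
      show False
      proof (cases "Suc j < n")
        case True
        then have "m = Suc j" using injD[OF eq] m by simp
        then show False using turn[of j] j m by simp
      next
        case False
        then have "x m = x n" using eq j m by (metis less_antisym not_less_eq)
        then show False using step[of m] m N[OF xV[of m]] by simp
      qed
    qed
  qed
  then have x0: "x n = x 0" using j by simp
  have n3: "n \<ge> 3"
  proof -
    have "n \<noteq> 1" using x0 step[of 0] N[OF xV[of 0]] by auto
    moreover have "n \<noteq> 2" using x0 turn[of 0] by (auto simp: numeral_2_eq_2)
    ultimately show ?thesis using m by linarith
  qed
  have xmod: "x ((i + 1) mod n) = x (Suc i)" if "i < n" for i
  proof (cases "Suc i = n")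
    case True
    then show ?thesis using x0 by simp
  next
    case False
    then show ?thesis using that by simp
  qed
  \<comment> \<open>The predecessor \<open>k\<close> is \<open>n - 1\<close> for
    \<open>i = 0\<close> and \<open>i - 1\<close> otherwise.\<close>
  have "\<exists>k<n. (k + 1) mod n = i \<and> N (x i) = {x k, x ((i + 1) mod n)}" if i: "i < n" for i
  proof (cases i)
    case 0
    have "x m \<noteq> x 1" using injD[of m 1] n3 m by auto
    then have "N (x 0) = {x m, x 1}"
      using \<open>x m \<in> N (x j)\<close> \<open>j = 0\<close> step[of 0] by (intro pair[OF xV]) auto
    then show ?thesis using 0 m n3 by (intro exI[of _ m]) auto
  next
    case (Suc k)
    then show ?thesis using nbrs[of k] xmod[OF i] i by (intro exI[of _ k]) auto
  qed
  then show ?thesis using that[OF n3 inj] xV by blast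
qed

subsection \<open>Connected quartic graphs\<close>

locale quartic =
  fixes G :: "('v, 'e) pgraph"
  assumes fin: "finite_pgraph G" and conn: "connected_pgraph G" and reg: "regular_pgraph 4 G"
begin

lemma finite_verts: "finite (verts G)" and finite_edges: "finite (edges G)"
  using fin by (auto simp: finite_pgraph_def)

lemma degree_4: "v \<in> verts G \<Longrightarrow> degree_in G (edges G) v = 4"
  using reg by (simp add: regular_pgraph_def)

lemma even_cut:
  assumes "D \<subseteq> verts G"
  shows "even (card (between G D (verts G - D)))"
proof -
  have "(\<Sum>v\<in>D. degree_in G (edges G) v) = 4 * card D"
    using assms degree_4 by (subst sum.cong[where h = "\<lambda>_. 4"]) auto
  then show ?thesis using parity_degree_sum[OF fin assms] by simp
qed

lemma closed_trivial:
  assumes "D \<subseteq> verts G" "between G D (verts G - D) = {}"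
  shows "D = {} \<or> D = verts G"
  using connected_pgraph_between[OF conn assms(1) _ _ fin] assms(2) by blast

lemma cut_eq_between:
  assumes "w \<in> verts G" "S \<subseteq> verts G - {w}" "between G S (verts G - insert w S) = {}"
  shows "between G S (verts G - S) = between G S {w}"
proof -
  have "verts G - S = {w} \<union> (verts G - insert w S)" using assms by auto
  then show ?thesis
    using assms(3) between_Un_left[of G "{w}" "verts G - insert w S" S]
    by (simp add: between_commute[of G S])
qed

text \<open>Every edge that leaves \<open>S\<close> ends in \<open>w\<close>. So the number of these
  edges is even because all degrees are, and positive for nonempty \<open>S\<close> because the
  graph is connected.\<close>

lemma attachment:
  assumes "w \<in> verts G" "S \<subseteq> verts G - {w}" "between G S (verts G - insert w S) = {}"
  shows "even (card (between G S {w}))" and "S \<noteq> {} \<Longrightarrow> card (between G S {w}) \<ge> 2"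
proof -
  have eq: "between G S (verts G - S) = between G S {w}"
    using cut_eq_between[OF assms] .
  have S: "S \<subseteq> verts G" using assms(2) by auto
  show ev: "even (card (between G S {w}))" using even_cut[OF S] eq by simp
  show "card (between G S {w}) \<ge> 2" if "S \<noteq> {}"
  proof -
    have "between G S {w} \<noteq> {}" using closed_trivial[OF S] eq that assms by auto
    then have "card (between G S {w}) \<noteq> 0" using finite_between[OF fin] by simp
    then show ?thesis using ev by (cases "card (between G S {w}) = 1") auto
  qed
qed

lemma degree_split:
  assumes "w \<in> verts G"
  shows "card (between G (verts G - {w}) {w}) + 2 * card (between G {w} {w}) = 4"
proof -
  have "{e \<in> edges G. w \<in> set_uprod (ends G e)} = between G (verts G - {w}) {w} \<union> between G {w} {w}"
  proof (intro equalityI subsetI)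
    fix e assume e: "e \<in> {e \<in> edges G. w \<in> set_uprod (ends G e)}"
    obtain p q where pq: "ends G e = Upair p q" by (cases "ends G e")
    then have "p \<in> verts G" "q \<in> verts G" using ends_in_verts[OF fin _ pq] e by auto
    then show "e \<in> between G (verts G - {w}) {w} \<union> between G {w} {w}"
      using e pq by (auto simp: between_def)
  qed (auto simp: between_def)
  moreover have "{e \<in> edges G. ends G e = Upair w w} = between G {w} {w}"
    by (auto simp: between_def)
  moreover have "between G (verts G - {w}) {w} \<inter> between G {w} {w} = {}"
    by (auto simp: between_def)
  ultimately show ?thesis
    using degree_4[OF assms] by (simp add: degree_in_def card_Un_disjoint finite_between[OF fin])
qed

text \<open>The degree 4 of \<open>w\<close>, split by where the edges lead, loops counting twice. A
  lower bound for one side at \<open>w\<close> thus becomes an upper bound for the other.\<close>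

lemma card_between_split:
  assumes "w \<in> verts G" "A \<subseteq> verts G - {w}"
  shows "card (between G A {w}) + card (between G (verts G - {w} - A) {w}) + 2 * card (between G {w} {w}) = 4"
proof -
  have "card (between G (A \<union> (verts G - {w} - A)) {w}) =
      card (between G A {w}) + card (between G (verts G - {w} - A) {w})"
    using assms by (intro card_between_Un_left[OF fin]) auto
  moreover have "A \<union> (verts G - {w} - A) = verts G - {w}" using assms by auto
  ultimately show ?thesis using degree_split[OF assms(1)] by simp
qed

lemma colorable_if_even_order:
  assumes "even (card (verts G))"
  shows "colorable 3 1 G"
proof -
  \<comment> \<open>By connectedness, the even order is the only parity condition for a join with
    all degrees odd.\<close>
  have "\<exists>J \<subseteq> between G (verts G) (verts G). \<forall>z\<in>verts G. odd (degree_in G J z) \<longleftrightarrow> z \<in> verts G"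
  proof (rule join_exists[OF fin])
    fix D assume "D \<subseteq> verts G" "between G D (verts G - D) = {}"
    then have "D = {} \<or> D = verts G" by (rule closed_trivial)
    then show "even (card (D \<inter> verts G))" using assms by auto
  qed auto
  then obtain J where J_between: "J \<subseteq> between G (verts G) (verts G)"
    and odd_J: "\<forall>z\<in>verts G. odd (degree_in G J z) \<longleftrightarrow> z \<in> verts G" by blast
  have J: "J \<subseteq> edges G" using J_between between_subset_edges by (rule subset_trans)
  define c :: "'e \<Rightarrow> nat" where "c e = (if e \<in> J then 0 else 1)" for e
  have J0: "{e \<in> edges G. c e = 0} = J" using J by (auto simp: c_def)
  have "is_coloring 3 1 G c"
  proof (rule is_coloringI)
    show "verts G \<noteq> {}" using conn by (simp add: connected_pgraph_def)
    fix v assume v: "v \<in> verts G"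
    show "\<exists>a b. a \<noteq> b \<and> color_degree G c a v = 3 \<and> color_degree G c b v = 1"
    proof (rule two_colors_odd[OF fin degree_4[OF v], of 0 1])
      show "odd (color_degree G c 0 v)" using odd_J v by (simp add: color_degree_def J0)
    qed (auto simp: c_def)
  qed
  then show ?thesis by (auto simp: colorable_def)
qed

text \<open>The edge \<open>f\<close> is the minority edge at both of its ends: all other edges at
  \<open>v\<close> get color 2, all others at \<open>x\<close> color 1. Elsewhere only colors 1 and
  2 occur, and the degree in color 2 has to be made odd; the parity assumption is the condition for
  the join that does so.\<close>

lemma colorable_if_removable_pair:
  assumes v: "v \<in> verts G" and x: "x \<in> verts G" and "v \<noteq> x"
    and f: "between G {v} {x} = {f}"
    and parity: "\<And>D. D \<subseteq> verts G - {v, x} \<Longrightarrow> between G D (verts G - {v, x} - D) = {} \<Longrightarrow>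
      even (card D) \<longleftrightarrow> even (card (between G D {v}))"
  shows "colorable 3 1 G"
proof -
  define Z where "Z = verts G - {v, x}"
  \<comment> \<open>All edges from \<open>Z\<close> to \<open>v\<close> get color 2. So a vertex
    with an odd number of them needs even degree in the join, and the vertices of \<open>T\<close>
    need odd degree.\<close>
  define T where "T = {z \<in> Z. even (card (between G {z} {v}))}"
  have finZ: "finite Z" using finite_verts by (simp add: Z_def)
  have "\<exists>J \<subseteq> between G Z Z. \<forall>z\<in>Z. odd (degree_in G J z) \<longleftrightarrow> z \<in> T"
  proof (rule join_exists[OF fin])
    show "Z \<subseteq> verts G" "T \<subseteq> Z" by (auto simp: Z_def T_def)
    fix D assume D: "D \<subseteq> Z" "between G D (Z - D) = {}"
    have finD: "finite D" using D finZ by (auto intro: finite_subset)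
    have "card D = card (D \<inter> T) + card (D - T)"
      using finD by (metis card_Int_Diff)
    \<comment> \<open>Modulo 2, only the vertices of \<open>D - T\<close> contribute to the number
      of edges between \<open>D\<close> and \<open>v\<close>.\<close>
    moreover have "even (card (between G D {v})) \<longleftrightarrow> even (card (D - T))"
    proof -
      have "v \<notin> D" using D by (auto simp: Z_def)
      moreover have "{z \<in> D. odd (card (between G {z} {v}))} = D - T"
        using D by (auto simp: T_def)
      ultimately show ?thesis
        using finD by (simp add: card_between_sum[OF fin] even_sum_iff)
    qed
    ultimately show "even (card (D \<inter> T))"
      using parity[of D] D unfolding Z_def by auto
  qed
  then obtain J where J: "J \<subseteq> between G Z Z" "\<And>z. z \<in> Z \<Longrightarrow> odd (degree_in G J z) \<longleftrightarrow> z \<in> T"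
    by blast
  have fE: "f \<in> edges G" "ends G f = Upair v x" using f by (auto simp: between_def)
  have f_unique: "e = f" if "e \<in> edges G" "v \<in> set_uprod (ends G e)" "x \<in> set_uprod (ends G e)" for e
  proof -
    have "ends G e = Upair v x"
      using that(2,3) \<open>v \<noteq> x\<close> by (cases "ends G e") auto
    then show ?thesis using f that(1) by (auto simp: between_def)
  qed
  have JE: "J \<subseteq> edges G" and JZ: "\<And>e. e \<in> J \<Longrightarrow> set_uprod (ends G e) \<subseteq> Z"
    using J(1) by (auto simp: between_def)
  have finJ: "finite J" using JE finite_edges by (rule finite_subset)
  define c :: "'e \<Rightarrow> nat"
    where "c e = (if e = f then 0 else if v \<in> set_uprod (ends G e) \<or> e \<in> J then 2 else 1)" for e
  have c0: "{e \<in> edges G. c e = 0} = {f}" using fE by (auto simp: c_def)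
  have "is_coloring 3 1 G c"
  proof (rule is_coloringI)
    show "verts G \<noteq> {}" using v by auto
    fix z assume z: "z \<in> verts G"
    consider "z = v" | "z = x" | "z \<in> Z" using z by (auto simp: Z_def)
    then show "\<exists>a b. a \<noteq> b \<and> color_degree G c a z = 3 \<and> color_degree G c b z = 1"
    proof cases
      case 1
      have "color_degree G c 0 z = 1"
        using 1 \<open>v \<noteq> x\<close> by (simp add: color_degree_def c0 degree_in_eq_sum incidence_Upair[OF fE(2)])
      then show ?thesis
        using 1 by (intro two_colors_odd[OF fin degree_4[OF z], of 0 2]) (auto simp: c_def)
    next
      case 2
      have "color_degree G c 0 z = 1"
        using 2 \<open>v \<noteq> x\<close> by (simp add: color_degree_def c0 degree_in_eq_sum incidence_Upair[OF fE(2)])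
      moreover have "c e = 0 \<or> c e = 1" if "e \<in> edges G" "z \<in> set_uprod (ends G e)" for e
        using that 2 f_unique[of e] JZ[of e] by (auto simp: c_def Z_def)
      ultimately show ?thesis
        by (intro two_colors_odd[OF fin degree_4[OF z], of 0 1]) auto
    next
      case 3
      have zne: "z \<noteq> v" "z \<noteq> x" using 3 by (auto simp: Z_def)
      have "color_degree G c 2 z = degree_in G (between G Z {v} \<union> J) z"
        unfolding color_degree_def
      proof (rule degree_in_cong_incident)
        show "finite {e \<in> edges G. c e = 2}" using finite_edges by simp
        show "finite (between G Z {v} \<union> J)" using finite_between[OF fin] finJ by simp
        fix e assume "incidence G e z \<noteq> 0"
        then have ez: "z \<in> set_uprod (ends G e)" by (simp add: incidence_eq_0_iff)
        then have "e \<noteq> f" using zne fE by auto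
        moreover have "v \<in> set_uprod (ends G e) \<and> e \<in> edges G \<longleftrightarrow> e \<in> between G Z {v}"
          using ez zne 3 by (cases "ends G e") (auto simp: between_def)
        ultimately show "e \<in> {e \<in> edges G. c e = 2} \<longleftrightarrow> e \<in> between G Z {v} \<union> J"
          using JE by (auto simp: c_def)
      qed
      also have "\<dots> = degree_in G (between G Z {v}) z + degree_in G J z"
      proof (rule degree_in_Un_disjoint)
        show "between G Z {v} \<inter> J = {}" using JZ by (fastforce simp: between_def Z_def)
      qed (use finite_between[OF fin] finJ in auto)
      also have "degree_in G (between G Z {v}) z = card (between G {z} {v})"
        using 3 by (intro degree_in_between[OF fin]) (auto simp: Z_def)
      finally have "odd (color_degree G c 2 z)"
        using J(2)[OF 3] 3 by (auto simp: T_def)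
      moreover have "c e = 2 \<or> c e = 1" if "e \<in> edges G" "z \<in> set_uprod (ends G e)" for e
        using that zne fE by (auto simp: c_def)
      ultimately show ?thesis
        by (intro two_colors_odd[OF fin degree_4[OF z], of 2 1]) auto
    qed
  qed
  then show ?thesis by (auto simp: colorable_def)
qed

subsection \<open>Two-edge cuts at a vertex\<close>

text \<open>
  The rest \<open>verts G - insert w S\<close> may be empty; then \<open>w\<close> carries a loop, which thus plays
  the role of the second side.
\<close>

definition two_cut :: "'v \<Rightarrow> 'v set \<Rightarrow> bool" where
  "two_cut w S \<longleftrightarrow> w \<in> verts G \<and> S \<subseteq> verts G - {w} \<and> S \<noteq> {} \<and>
     between G S (verts G - insert w S) = {} \<and> card (between G S {w}) = 2"

lemma two_cut_edges:
  assumes "two_cut w S"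
  obtains f1 f2 u v where "between G S {w} = {f1, f2}" "f1 \<noteq> f2" "u \<in> S" "v \<in> S"
    "ends G f1 = Upair u w" "ends G f2 = Upair v w"
proof -
  obtain f1 f2 where f: "between G S {w} = {f1, f2}" "f1 \<noteq> f2"
    using assms by (auto simp: two_cut_def card_2_iff)
  then have "f1 \<in> between G S {w}" "f2 \<in> between G S {w}" by auto
  then obtain u v where "u \<in> S" "ends G f1 = Upair u w" "v \<in> S" "ends G f2 = Upair v w"
    by (auto simp: between_def)
  then show ?thesis using that f by blast
qed

text \<open>By \<open>attachment\<close> the number of edges to \<open>w\<close> is even and at
  least 2, so an upper bound of 3 makes it 2.\<close>

lemma two_cutI:
  assumes "w \<in> verts G" "S \<subseteq> verts G - {w}" "S \<noteq> {}" "between G S (verts G - insert w S) = {}"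
    and "card (between G S {w}) \<le> 3"
  shows "two_cut w S"
proof -
  have "card (between G S {w}) = 2"
    using attachment[OF assms(1,2,4)] assms(3,5) by (cases "card (between G S {w}) = 3") auto
  then show ?thesis using assms by (simp add: two_cut_def)
qed

text \<open>One side of an adhesion, recovered from a \<open>two_cut\<close>: the two edges from
  \<open>S\<close> to \<open>w\<close> are merged into one edge between their ends \<open>u\<close>
  and \<open>v\<close> in \<open>S\<close>, a loop if \<open>u = v\<close>. In the applications it
  keeps the name \<open>f\<close> of one of the two.\<close>

definition suppress :: "'v set \<Rightarrow> 'e \<Rightarrow> 'v \<Rightarrow> 'v \<Rightarrow> ('v, 'e) pgraph" where
  "suppress S f u v = \<lparr>verts = S, edges = insert f (between G S S), ends = (ends G)(f := Upair u v)\<rparr>"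

section \<open>The graph on one side of a two-edge cut\<close>

context
  fixes w S f1 f2 u v
  assumes cut: "two_cut w S"
    and f: "between G S {w} = {f1, f2}" "f1 \<noteq> f2" "ends G f1 = Upair u w" "ends G f2 = Upair v w"
    and uv: "u \<in> S" "v \<in> S"
begin

private lemma S: "w \<in> verts G" "S \<subseteq> verts G" "w \<notin> S" "S \<noteq> {}"
  using cut by (auto simp: two_cut_def)

private lemma f_edges: "f1 \<in> edges G" "f2 \<in> edges G"
  using f(1) between_subset_edges[of G S "{w}"] by auto

private lemma f_not_inside: "f1 \<notin> between G S S" "f2 \<notin> between G S S"
  using f(3,4) S(3) by (auto simp: between_def)

lemma incident_two_cut:
  assumes "e \<in> edges G" "z \<in> S" "z \<in> set_uprod (ends G e)"
  shows "e \<in> between G S S \<or> e \<in> {f1, f2}"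
proof -
  obtain y where y: "ends G e = Upair z y"
    using assms(3) by (cases "ends G e") auto
  have "y \<in> verts G" using ends_in_verts(2)[OF fin assms(1) y] .
  moreover have "y \<notin> verts G - insert w S"
    using cut assms y by (auto simp: two_cut_def between_def)
  ultimately consider "y = w" | "y \<in> S" by blast
  then show ?thesis
    using assms y f(1)[symmetric] by cases (auto simp: between_def)
qed

lemma finite_suppress: "finite_pgraph (suppress S f1 u v)"
  using S uv finite_verts finite_between[OF fin]
  by (auto simp: suppress_def finite_pgraph_def between_def intro: finite_subset)

text \<open>The instance of \<open>color_degree_suppress\<close> in which \<open>f1\<close> names
  both the subdivided edge and one of its halves.\<close>

lemma color_degree_suppress_cut:
  assumes "z \<in> S" "\<And>e. e \<in> between G S S \<Longrightarrow> c e = c1 e" "c f1 = c1 f1" "c f2 = c1 f1"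
  shows "color_degree (suppress S f1 u v) c1 a z = color_degree G c a z"
proof (rule color_degree_suppress[OF finite_suppress fin])
  show "f1 \<in> edges (suppress S f1 u v)" "ends (suppress S f1 u v) f1 = Upair u v"
    by (auto simp: suppress_def)
  show "f1 \<noteq> f2" "ends G f1 = Upair u w" "ends G f2 = Upair v w" using f by auto
  show "{f1, f2} \<subseteq> edges G" using f_edges by simp
  show "w \<noteq> z" using assms(1) S by auto
  have E: "edges (suppress S f1 u v) - {f1} = between G S S"
    using f_not_inside by (auto simp: suppress_def)
  show "{f1, f2} \<inter> (edges (suppress S f1 u v) - {f1}) = {}"
    using f_not_inside by (auto simp: E)
  show "e \<in> edges G \<and> ends G e = ends (suppress S f1 u v) e \<and> c e = c1 e"
    if "e \<in> edges (suppress S f1 u v) - {f1}" for e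
    using that assms(2)[of e] f_not_inside between_subset_edges[of G S S]
    unfolding E by (auto simp: suppress_def)
  show "e \<in> edges (suppress S f1 u v) - {f1} \<or> e \<in> {f1, f2}"
    if "e \<in> edges G" "z \<in> set_uprod (ends G e)" for e
    using incident_two_cut[OF that(1) assms(1) that(2)] unfolding E .
qed (use assms in auto)

lemma regular_suppress: "regular_pgraph 4 (suppress S f1 u v)"
  unfolding regular_pgraph_def
proof
  fix z assume "z \<in> verts (suppress S f1 u v)"
  then have z: "z \<in> S" by (simp add: suppress_def)
  \<comment> \<open>With a single color, color degrees are degrees.\<close>
  have "color_degree (suppress S f1 u v) (\<lambda>_. ()) () z = color_degree G (\<lambda>_. ()) () z"
    using z by (rule color_degree_suppress_cut) auto
  then show "degree_in (suppress S f1 u v) (edges (suppress S f1 u v)) z = 4"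
    using degree_4[of z] z S by (auto simp: color_degree_def)
qed

text \<open>A closed set \<open>D\<close> contains both or neither of \<open>u\<close> and
  \<open>v\<close>, because \<open>f1\<close> joins them. So \<open>D\<close> or
  \<open>S - D\<close> avoids both; as the only edges leaving \<open>S\<close> start at
  \<open>u\<close> and \<open>v\<close>, that set is closed in \<open>G\<close> too and hence
  empty.\<close>

lemma connected_suppress: "connected_pgraph (suppress S f1 u v)"
proof (rule connected_pgraphI[OF finite_suppress])
  show "verts (suppress S f1 u v) \<noteq> {}" using S by (simp add: suppress_def)
  fix D assume D: "D \<subseteq> verts (suppress S f1 u v)" "D \<noteq> {}"
    and closed: "between (suppress S f1 u v) D (verts (suppress S f1 u v) - D) = {}"
  have DS: "D \<subseteq> S" using D by (simp add: suppress_def)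
  have "u \<in> D \<longleftrightarrow> v \<in> D"
  proof (rule ccontr)
    assume "\<not> (u \<in> D \<longleftrightarrow> v \<in> D)"
    then have "f1 \<in> between (suppress S f1 u v) D (S - D)"
      using uv by (auto simp: between_def suppress_def)
    then show False using closed by (simp add: suppress_def)
  qed
  have no_inner: "between G D (S - D) = {}"
  proof (rule ccontr)
    assume "between G D (S - D) \<noteq> {}"
    then obtain e a b where e: "e \<in> edges G" "a \<in> D" "b \<in> S - D" "ends G e = Upair a b"
      by (auto simp: between_def)
    then have "e \<noteq> f1" using f(3) DS S(3) by auto
    then have "e \<in> between (suppress S f1 u v) D (S - D)"
      using e DS by (auto simp: between_def suppress_def)
    then show False using closed by (simp add: suppress_def)
  qed
  have avoid: "A = {}" if A: "A \<subseteq> S" "u \<notin> A" "v \<notin> A" "between G A (S - A) = {}" for A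
  proof -
    have "between G A (verts G - A) = {}"
    proof (rule ccontr)
      assume "between G A (verts G - A) \<noteq> {}"
      then obtain e a b where e: "e \<in> edges G" "a \<in> A" "b \<in> verts G - A" "ends G e = Upair a b"
        by (auto simp: between_def)
      then have "a \<in> S" "a \<noteq> u" "a \<noteq> v" using A by auto
      then have "e \<in> between G S S"
        using incident_two_cut[OF e(1) \<open>a \<in> S\<close>] e f A S(3) by auto
      then have "b \<in> S" using e by (auto simp: between_def)
      then show False using e A(4) by (auto simp: between_def)
    qed
    then have "A = {} \<or> A = verts G" using A S by (intro closed_trivial) auto
    then show ?thesis using A S by auto
  qed
  have "D = S"
  proof (cases "u \<in> D")
    case True
    then have "S - D = {}"
    proof (intro avoid)
      have "S - (S - D) = D" using DS by auto
      then show "between G (S - D) (S - (S - D)) = {}"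
        using no_inner by (simp add: between_commute)
    qed (use \<open>u \<in> D \<longleftrightarrow> v \<in> D\<close> in auto)
    then show ?thesis using DS by auto
  next
    case False
    then show ?thesis
      using avoid[OF DS] no_inner \<open>u \<in> D \<longleftrightarrow> v \<in> D\<close> D(2) by auto
  qed
  then show "D = verts (suppress S f1 u v)" by (simp add: suppress_def)
qed

text \<open>The vertices outside \<open>S\<close>, including \<open>w\<close>, are even in number
  and induce a connected graph, so they have a join with all degrees odd. It is given the color of
  \<open>f1\<close>; at \<open>w\<close>, the edges \<open>f1\<close> and \<open>f2\<close> add 2 to
  the degree in this color and leave it odd.\<close>

lemma colorable_of_suppress:
  assumes "colorable 3 1 (suppress S f1 u v)" "odd (card S)" "odd (card (verts G))"
  shows "colorable 3 1 G"
proof -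
  obtain c1 :: "'e \<Rightarrow> nat" where c1: "is_coloring 3 1 (suppress S f1 u v) c1"
    using assms(1) by (auto simp: colorable_def)
  define Z where "Z = verts G - S"
  have evenZ: "even (card Z)"
    using assms(2,3) S finite_verts by (simp add: Z_def card_Diff_subset finite_subset card_mono)
  have S_out: "between G S (Z - {w}) = {}"
  proof -
    have "Z - {w} = verts G - insert w S" by (auto simp: Z_def)
    then show ?thesis using cut by (simp add: two_cut_def)
  qed
  have "\<exists>J \<subseteq> between G Z Z. \<forall>z\<in>Z. odd (degree_in G J z) \<longleftrightarrow> z \<in> Z"
  proof (rule join_exists[OF fin])
    fix D assume D: "D \<subseteq> Z" "between G D (Z - D) = {}"
    \<comment> \<open>No edge joins \<open>S\<close> to \<open>Z - {w}\<close>, so a set that avoids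
      \<open>w\<close> and is closed within \<open>Z\<close> is closed in \<open>G\<close>.\<close>
    have avoid: "A = {}" if A: "A \<subseteq> Z - {w}" "between G A (Z - A) = {}" for A
    proof -
      have "between G A S = {}"
        using S_out between_mono[OF A(1) subset_refl, of G S] by (auto simp: between_commute)
      moreover have "verts G - A = S \<union> (Z - A)" using A S by (auto simp: Z_def)
      ultimately have "between G A (verts G - A) = {}"
        using A(2) by (simp add: between_commute[of G A] between_Un_left)
      then have "A = {} \<or> A = verts G" using A by (intro closed_trivial) (auto simp: Z_def)
      then show ?thesis using A S by auto
    qed
    show "even (card (D \<inter> Z))"
    proof (cases "w \<in> D")
      case True
      then have "Z - D = {}"
      proof (intro avoid)
        have "Z - (Z - D) = D" using D by auto
        then show "between G (Z - D) (Z - (Z - D)) = {}"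
          using D(2) by (simp add: between_commute)
      qed auto
      then have "D \<inter> Z = Z" using D by auto
      then show ?thesis using evenZ by simp
    next
      case False
      then have "D = {}" using D by (intro avoid) auto
      then show ?thesis by simp
    qed
  qed (auto simp: Z_def)
  then obtain J where J: "J \<subseteq> between G Z Z" "\<forall>z\<in>Z. odd (degree_in G J z) \<longleftrightarrow> z \<in> Z"
    by blast
  have JE: "J \<subseteq> edges G" and JZ: "\<And>e. e \<in> J \<Longrightarrow> set_uprod (ends G e) \<subseteq> Z"
    using J(1) by (auto simp: between_def)
  have finJ: "finite J" using JE finite_edges by (rule finite_subset)
  have fJ: "f1 \<notin> J" "f2 \<notin> J" using JZ[of f1] JZ[of f2] f uv by (auto simp: Z_def)
  define a where "a = c1 f1"
  \<comment> \<open>\<open>Suc a\<close> serves as an arbitrary color other than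
    \<open>a\<close>.\<close>
  define c where "c e = (if e \<in> between G S S then c1 e else if e \<in> {f1, f2} \<union> J then a else Suc a)" for e
  have "is_coloring 3 1 G c"
  proof (rule is_coloringI)
    show "verts G \<noteq> {}" using S by auto
    fix z assume z: "z \<in> verts G"
    show "\<exists>a b. a \<noteq> b \<and> color_degree G c a z = 3 \<and> color_degree G c b z = 1"
    proof (cases "z \<in> S")
      case True
      have eq: "color_degree (suppress S f1 u v) c1 b z = color_degree G c b z" for b
        using True f_not_inside by (intro color_degree_suppress_cut) (auto simp: c_def a_def)
      have "z \<in> verts (suppress S f1 u v)" using True by (simp add: suppress_def)
      then have "\<exists>a b. a \<noteq> b \<and> color_degree (suppress S f1 u v) c1 a z = 3 \<and>
          color_degree (suppress S f1 u v) c1 b z = 1"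
        using c1 unfolding is_coloring_def by blast
      then show ?thesis unfolding eq .
    next
      case False
      then have zZ: "z \<in> Z" using z by (simp add: Z_def)
      have outside: "e \<notin> between G S S" if "z \<in> set_uprod (ends G e)" for e
        using that False by (auto simp: between_def)
      have "color_degree G c a z = degree_in G ({f1, f2} \<union> J) z"
        unfolding color_degree_def
      proof (rule degree_in_cong_incident)
        fix e assume "incidence G e z \<noteq> 0"
        then have "e \<notin> between G S S" using outside by (simp add: incidence_eq_0_iff)
        then show "e \<in> {e \<in> edges G. c e = a} \<longleftrightarrow> e \<in> {f1, f2} \<union> J"
          using JE f_edges by (auto simp: c_def)
      qed (use finite_edges finJ in auto)
      also have "\<dots> = degree_in G {f1, f2} z + degree_in G J z"
        using finJ fJ by (intro degree_in_Un_disjoint) auto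
      also have "degree_in G {f1, f2} z = 2 * of_bool (z = w)"
        using f(2) False uv
        by (auto simp: degree_in_eq_sum incidence_Upair[OF f(3)] incidence_Upair[OF f(4)])
      finally have "odd (color_degree G c a z)" using J(2) zZ by simp
      moreover have "c e = a \<or> c e = Suc a" if "e \<in> edges G" "z \<in> set_uprod (ends G e)" for e
        using outside[OF that(2)] by (auto simp: c_def)
      ultimately show ?thesis
        by (intro two_colors_odd[OF fin degree_4[OF z], of a "Suc a"]) auto
    qed
  qed
  then show ?thesis by (auto simp: colorable_def)
qed

end

text \<open>For a smallest \<open>S\<close>, \<open>colorable_if_removable_pair\<close> applies to
  \<open>w\<close> and its neighbor \<open>u\<close> in \<open>S\<close>: minimality makes
  \<open>S - {u}\<close> connected, and evenness of all such sets supplies the parities.\<close>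

lemma colorable_if_even_two_cut:
  assumes no_odd: "\<And>w S. two_cut w S \<Longrightarrow> even (card S)" and ex: "\<exists>w S. two_cut w S"
  shows "colorable 3 1 G"
proof -
  obtain w S where cut: "two_cut w S" and minimal: "\<And>w' S'. two_cut w' S' \<Longrightarrow> card S \<le> card S'"
  proof -
    obtain w0 S0 where "case_prod two_cut (w0, S0)" using ex by auto
    then obtain p where "case_prod two_cut p" "\<forall>q. case_prod two_cut q \<longrightarrow> card (snd p) \<le> card (snd q)"
      using ex_has_least_nat[of "case_prod two_cut" "(w0, S0)" "\<lambda>q. card (snd q)"] by blast
    then show ?thesis using that[of "fst p" "snd p"] by (auto simp: case_prod_beta)
  qed
  obtain f1 f2 u v where f: "between G S {w} = {f1, f2}" "f1 \<noteq> f2" "u \<in> S" "v \<in> S"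
    "ends G f1 = Upair u w" "ends G f2 = Upair v w"
    using two_cut_edges[OF cut] .
  have S: "w \<in> verts G" "S \<subseteq> verts G" "w \<notin> S" "S \<noteq> {}" "between G S (verts G - insert w S) = {}"
    using cut by (auto simp: two_cut_def)
  have fE: "f1 \<in> edges G" "f2 \<in> edges G"
    using f(1) between_subset_edges[of G S "{w}"] by auto
  have finS: "finite S" using S(2) finite_verts by (rule finite_subset)
  have to_w: "e = f1 \<or> e = f2" if "e \<in> edges G" "ends G e = Upair a w" "a \<in> S" for e a
  proof -
    have "e \<in> between G S {w}" using that by (auto simp: between_def)
    then show ?thesis by (simp add: f(1))
  qed
  have from_S: "b \<in> S \<or> b = w" if "e \<in> edges G" "ends G e = Upair a b" "a \<in> S" for e a b
    using that S(5) ends_in_verts(2)[OF fin that(1,2)] by (auto simp: between_def)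
  show ?thesis
  proof (cases "u = v")
    case True
    have "S - {u} \<noteq> {}"
    proof
      assume "S - {u} = {}"
      then have "S = {u}" using f(3) by auto
      then show False using no_odd[OF cut] by simp
    qed
    \<comment> \<open>Both edges from \<open>S\<close> to \<open>w\<close> start at
      \<open>u\<close>, so \<open>S - {u}\<close> is attached to \<open>u\<close> alone, by at most
      two edges. Its order is odd, a contradiction.\<close>
    have "two_cut u (S - {u})"
    proof (rule two_cutI)
      show "between G (S - {u}) (verts G - insert u (S - {u})) = {}"
      proof (rule ccontr)
        assume "between G (S - {u}) (verts G - insert u (S - {u})) \<noteq> {}"
        then obtain e a b where e: "e \<in> edges G" "a \<in> S - {u}" "b \<in> verts G - insert u (S - {u})"
          "ends G e = Upair a b" by (auto simp: between_def)
        then have "b = w" using from_S[OF e(1,4)] by auto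
        then have "e = f1 \<or> e = f2" using to_w[OF e(1)] e by auto
        then show False using e f True \<open>b = w\<close> S(3) by auto
      qed
      have "f1 \<in> between G (verts G - {u} - (S - {u})) {u}" "f2 \<in> between G (verts G - {u} - (S - {u})) {u}"
        using f True S fE by (auto simp: between_def)
      then have "card {f1, f2} \<le> card (between G (verts G - {u} - (S - {u})) {u})"
        by (intro card_mono finite_between[OF fin]) auto
      moreover have "u \<in> verts G" "S - {u} \<subseteq> verts G - {u}" using f(3) S(2) by auto
      ultimately show "card (between G (S - {u}) {u}) \<le> 3"
        using card_between_split[of u "S - {u}"] f(2) by simp
    qed (use S f \<open>S - {u} \<noteq> {}\<close> in auto)
    then have "even (card (S - {u}))" by (rule no_odd)
    moreover have "card S = Suc (card (S - {u}))" by (rule card.remove[OF finS f(3)])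
    ultimately show ?thesis using no_odd[OF cut] by simp
  next
    case False
    have wu: "between G {w} {u} = {f1}"
    proof (intro equalityI subsetI)
      fix e assume "e \<in> between G {w} {u}"
      then have e: "e \<in> edges G" "ends G e = Upair u w" by (auto simp: between_def)
      then have "e = f1 \<or> e = f2" using to_w f(3) by blast
      then show "e \<in> {f1}" using e f False S by auto
    qed (use f fE in \<open>auto simp: between_def\<close>)
    \<comment> \<open>A component of \<open>S - {u}\<close> without \<open>v\<close> would be
      attached to \<open>u\<close> alone. As \<open>f1\<close> takes one of the four incidences at
      \<open>u\<close>, at most 3 edges remain, and a smaller \<open>two_cut\<close> arises.\<close>
    have sub_u: "A = {}" if A: "A \<subseteq> S - {u, v}" "between G A (S - {u} - A) = {}" for A
    proof (rule ccontr)
      assume "A \<noteq> {}"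
      have "two_cut u A"
      proof (rule two_cutI)
        show "between G A (verts G - insert u A) = {}"
        proof (rule ccontr)
          assume "between G A (verts G - insert u A) \<noteq> {}"
          then obtain e a b where e: "e \<in> edges G" "a \<in> A" "b \<in> verts G - insert u A"
            "ends G e = Upair a b" by (auto simp: between_def)
          have aS: "a \<in> S" "a \<noteq> u" "a \<noteq> v" using e A by auto
          have "b \<noteq> w"
          proof
            assume "b = w"
            then have "e = f1 \<or> e = f2" using to_w e aS by blast
            then show False using e f aS \<open>b = w\<close> S(3) by auto
          qed
          then have "b \<in> S - {u} - A" using from_S[OF e(1,4)] aS e by auto
          then show False using A(2) e by (auto simp: between_def)
        qed
        have "f1 \<in> between G (verts G - {u} - A) {u}"
          using f S fE A by (auto simp: between_def)
        then have "card {f1} \<le> card (between G (verts G - {u} - A) {u})"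
          by (intro card_mono finite_between[OF fin]) auto
        moreover have "A \<subseteq> verts G - {u}" "u \<in> verts G" using A S f by auto
        ultimately show "card (between G A {u}) \<le> 3"
          using card_between_split[of u A] by auto
      qed (use A S f \<open>A \<noteq> {}\<close> in auto)
      then have "card S \<le> card A" by (rule minimal)
      moreover have "card A < card S" using A f(3) finS by (intro psubset_card_mono) auto
      ultimately show False by simp
    qed
    show ?thesis
    proof (rule colorable_if_removable_pair[OF _ _ _ wu])
      fix D assume D: "D \<subseteq> verts G - {w, u}" "between G D (verts G - {w, u} - D) = {}"
      have finD: "finite D" using D finite_verts by (auto intro: finite_subset)
      \<comment> \<open>Edges leave \<open>S\<close> only towards \<open>w\<close>, so the two parts
        of \<open>D\<close> are treated separately: \<open>A\<close> is empty or all of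
        \<open>S - {u}\<close>, and \<open>B\<close> is empty or forms a \<open>two_cut\<close> at
        \<open>w\<close>.\<close>
      define A B where "A = D \<inter> S" and "B = D - S"
      have DAB: "D = A \<union> B" "A \<inter> B = {}" by (auto simp: A_def B_def)
      have no_D: False if "e \<in> edges G" "ends G e = Upair a b" "a \<in> D" "b \<in> verts G - {w, u}" "b \<notin> D" for e a b
        using D(2) that by (auto simp: between_def)
      have closedA: "between G A (S - {u} - A) = {}"
      proof (rule ccontr)
        assume "between G A (S - {u} - A) \<noteq> {}"
        then obtain e a b where "e \<in> edges G" "a \<in> A" "b \<in> S - {u} - A" "ends G e = Upair a b"
          by (auto simp: between_def)
        then show False using no_D[of e a b] S by (auto simp: A_def)
      qed
      have parA: "even (card A) \<longleftrightarrow> even (card (between G A {w}))"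
      proof (cases "v \<in> A")
        case True
        have "S - {u} - A = {}"
        proof (rule sub_u)
          have "S - {u} - (S - {u} - A) = A" using D by (auto simp: A_def)
          then show "between G (S - {u} - A) (S - {u} - (S - {u} - A)) = {}"
            using closedA by (simp add: between_commute)
        qed (use True in auto)
        then have A: "A = S - {u}" using D by (auto simp: A_def)
        then have "card S = Suc (card A)" using card.remove[OF finS f(3)] by simp
        then have "odd (card A)" using no_odd[OF cut] by simp
        \<comment> \<open>Of the two edges from \<open>S\<close> to \<open>w\<close>,
          \<open>f1\<close> starts at \<open>u\<close>; the single edge left matches the odd order
          of \<open>A\<close>.\<close>
        moreover have "between G A {w} = {f2}"
        proof (intro equalityI subsetI)
          fix e assume "e \<in> between G A {w}"
          then obtain a where e: "e \<in> edges G" "ends G e = Upair a w" "a \<in> A" by (auto simp: between_def)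
          then have "e = f1 \<or> e = f2" using to_w A by blast
          then show "e \<in> {f2}" using e f A S by auto
        qed (use f fE True in \<open>auto simp: between_def\<close>)
        ultimately show ?thesis by simp
      next
        case False
        then have "A = {}" using closedA D by (intro sub_u) (auto simp: A_def)
        then show ?thesis by (simp add: between_def)
      qed
      have parB: "even (card B) \<and> even (card (between G B {w}))"
      proof (cases "B = {}")
        case True
        then show ?thesis by (simp add: between_def)
      next
        case False
        have "two_cut w B"
        proof (rule two_cutI)
          show "between G B (verts G - insert w B) = {}"
          proof (rule ccontr)
            assume "between G B (verts G - insert w B) \<noteq> {}"
            then obtain e a b where e: "e \<in> edges G" "a \<in> B" "b \<in> verts G - insert w B" "ends G e = Upair a b"
              by (auto simp: between_def)
            have "ends G e = Upair b a" using e(4) by auto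
            then have "b \<notin> S" using from_S[of e b a] e D by (auto simp: B_def)
            then show False using no_D[OF e(1,4)] e f(3) by (auto simp: B_def)
          qed
          \<comment> \<open>The set \<open>S\<close> already takes two of the four incidences at
            \<open>w\<close>, which leaves at most two for \<open>B\<close>.\<close>
          have sub: "between G S {w} \<subseteq> between G (verts G - {w} - B) {w}"
            using S by (intro between_mono) (auto simp: B_def)
          have "card (between G S {w}) \<le> card (between G (verts G - {w} - B) {w})"
            by (rule card_mono[OF finite_between[OF fin] sub])
          moreover have "B \<subseteq> verts G - {w}" using D by (auto simp: B_def)
          ultimately show "card (between G B {w}) \<le> 3"
            using card_between_split[of w B] S(1) cut by (auto simp: two_cut_def)
        qed (use D S False in \<open>auto simp: B_def\<close>)
        then show ?thesis using no_odd by (auto simp: two_cut_def)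
      qed
      have "card D = card A + card B"
        unfolding DAB(1) using DAB finD by (intro card_Un_disjoint) auto
      moreover have "card (between G D {w}) = card (between G A {w}) + card (between G B {w})"
        unfolding DAB(1) using DAB(2) D(1) by (intro card_between_Un_left[OF fin]) (auto simp: A_def B_def)
      ultimately show "even (card D) \<longleftrightarrow> even (card (between G D {w}))"
        using parA parB by simp
    qed (use S f in auto)
  qed
qed

section \<open>Graphs without two-edge cuts at a vertex\<close>

context
  assumes no_cut: "\<And>w S. \<not> two_cut w S"
begin

text \<open>No vertex separates the graph: if \<open>D\<close> and the rest of G - w were both
  nonempty, each would send at least 2 of the at most 4 edges to \<open>w\<close>, and
  \<open>D\<close> would form a \<open>two_cut\<close>.\<close>

lemma closed_avoiding_vertex:
  assumes "w \<in> verts G" "D \<subseteq> verts G - {w}" "between G D (verts G - insert w D) = {}"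
  shows "D = {} \<or> D = verts G - {w}"
proof (rule ccontr)
  assume neg: "\<not> (D = {} \<or> D = verts G - {w})"
  define D' where "D' = verts G - {w} - D"
  have D': "D' \<subseteq> verts G - {w}" "D' \<noteq> {}" using neg assms by (auto simp: D'_def)
  have "D' = verts G - insert w D" "verts G - insert w D' = D" using assms by (auto simp: D'_def)
  then have "between G D' (verts G - insert w D') = {}"
    using assms(3) by (simp add: between_commute)
  then have "card (between G D' {w}) \<ge> 2" using attachment(2)[OF assms(1) D'(1)] D'(2) by blast
  then have "card (between G D {w}) \<le> 3"
    using card_between_split[OF assms(1,2)] by (simp add: D'_def)
  then have "two_cut w D" using neg assms by (intro two_cutI) auto
  then show False using no_cut by blast
qed

text \<open>A loop uses up two of the four incidences at \<open>w\<close>, so the set of all other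
  vertices would form a \<open>two_cut\<close>.\<close>

lemma no_loops:
  assumes "card (verts G) \<ge> 2" "w \<in> verts G"
  shows "card (between G {w} {w}) = 0"
proof (rule ccontr)
  assume "card (between G {w} {w}) \<noteq> 0"
  then have "card (between G (verts G - {w}) {w}) \<le> 3" using degree_split[OF assms(2)] by simp
  moreover have "verts G - {w} \<noteq> {}"
  proof
    assume "verts G - {w} = {}"
    then have "verts G = {w}" using assms by auto
    then show False using assms by simp
  qed
  moreover have "verts G - insert w (verts G - {w}) = {}" by auto
  then have "between G (verts G - {w}) (verts G - insert w (verts G - {w})) = {}" by (auto simp: between_def)
  ultimately have "two_cut w (verts G - {w})" using assms by (intro two_cutI) auto
  then show False using no_cut by blast
qed

text \<open>If G - v - x falls into \<open>D\<close> and \<open>D'\<close>, one of them sends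
  exactly one edge to \<open>v\<close>; the end \<open>a\<close> of this edge replaces
  \<open>x\<close>. Then G - v - a is connected, as otherwise \<open>a\<close> or \<open>v\<close>
  would separate the graph.\<close>

lemma simple_neighbor_nonseparating:
  assumes v: "v \<in> verts G" and x: "x \<in> verts G" "x \<noteq> v" and simple: "card (between G {v} {x}) = 1"
  obtains a where "a \<in> verts G" "a \<noteq> v" "card (between G {v} {a}) = 1"
    "\<And>D. D \<subseteq> verts G - {v, a} \<Longrightarrow> between G D (verts G - {v, a} - D) = {} \<Longrightarrow>
       D = {} \<or> D = verts G - {v, a}"
proof (cases "\<exists>D. D \<subseteq> verts G - {v, x} \<and> between G D (verts G - {v, x} - D) = {} \<and>
       D \<noteq> {} \<and> D \<noteq> verts G - {v, x}")
  case False
  then show ?thesis using that[OF x simple] by blast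
next
  case True
  then obtain D where D: "D \<subseteq> verts G - {v, x}" "between G D (verts G - {v, x} - D) = {}"
    "D \<noteq> {}" "D \<noteq> verts G - {v, x}" by blast
  define D' where "D' = verts G - {v, x} - D"
  have DD': "D' \<subseteq> verts G - {v, x}" "between G D' (verts G - {v, x} - D') = {}" "D' \<noteq> {}"
    "verts G - {v, x} = D \<union> D'" "D \<inter> D' = {}"
  proof -
    have "verts G - {v, x} - D' = D" using D by (auto simp: D'_def)
    then show "between G D' (verts G - {v, x} - D') = {}"
      using D(2) by (simp add: between_commute D'_def)
  qed (use D in \<open>auto simp: D'_def\<close>)
  \<comment> \<open>A part without an edge to \<open>v\<close> would be separated from
    \<open>v\<close> by \<open>x\<close>.\<close>
  have touch: "card (between G E {v}) \<noteq> 0"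
    if E: "E \<subseteq> verts G - {v, x}" "between G E (verts G - {v, x} - E) = {}" "E \<noteq> {}" for E
  proof
    assume "card (between G E {v}) = 0"
    then have "between G E {v} = {}" using finite_between[OF fin] by simp
    moreover have "verts G - insert x E = {v} \<union> (verts G - {v, x} - E)" using E v x by auto
    ultimately have "between G E (verts G - insert x E) = {}"
      using E(2) between_Un_left[of G "{v}" "verts G - {v, x} - E" E]
      by (simp add: between_commute[of G E])
    then have "E = {} \<or> E = verts G - {x}" using E x by (intro closed_avoiding_vertex) auto
    then show False using E v x by auto
  qed
  \<comment> \<open>The simple edge to \<open>x\<close> leaves at most three edges at
    \<open>v\<close>, and both parts receive some, so one of them receives exactly one.\<close>
  have "card (between G D {v}) + card (between G D' {v}) \<le> 3"
  proof -
    have "verts G - {v} - {x} = D \<union> D'" using DD' by auto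
    then have "card (between G {x} {v}) + card (between G (D \<union> D') {v}) \<le> 4"
      using card_between_split[of v "{x}"] v x by auto
    moreover have "card (between G (D \<union> D') {v}) = card (between G D {v}) + card (between G D' {v})"
      using D DD' by (intro card_between_Un_left[OF fin]) auto
    ultimately show ?thesis using simple by (simp add: between_commute)
  qed
  moreover have "card (between G D {v}) \<noteq> 0" "card (between G D' {v}) \<noteq> 0"
    using touch[OF D(1,2,3)] touch[OF DD'(1,2,3)] by auto
  ultimately have "card (between G D {v}) = 1 \<or> card (between G D' {v}) = 1" by linarith
  then obtain C where C: "C \<subseteq> verts G - {v, x}" "between G C (verts G - {v, x} - C) = {}"
    "card (between G C {v}) = 1"
    using D DD' by blast
  then obtain g where g: "between G C {v} = {g}" by (auto simp: card_1_singleton_iff)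
  then have "g \<in> between G C {v}" by simp
  then obtain a where a: "a \<in> C" "ends G g = Upair a v" "g \<in> edges G" by (auto simp: between_def)
  have to_v: "y = a" if "e \<in> edges G" "ends G e = Upair y v" "y \<in> C" for e y
  proof -
    have "e \<in> between G C {v}" using that by (auto simp: between_def)
    then have "e = g" using g by simp
    then show ?thesis using that a by auto
  qed
  have leave_C: "z \<in> C \<or> z = v \<or> z = x" if "e \<in> edges G" "ends G e = Upair y z" "y \<in> C" for e y z
    using C(2) that ends_in_verts(2)[OF fin that(1,2)] by (auto simp: between_def)
  have av: "a \<in> verts G" "a \<noteq> v" "a \<noteq> x" using a C by auto
  have "between G {v} {a} = {g}"
  proof (intro equalityI subsetI)
    fix e assume "e \<in> between G {v} {a}"
    then have "e \<in> between G C {v}" using a by (auto simp: between_def)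
    then show "e \<in> {g}" using g by simp
  qed (use a in \<open>auto simp: between_def\<close>)
  \<comment> \<open>Of a closed set and its complement in G - v - a, one avoids \<open>x\<close>, so
    only such sets \<open>B\<close> matter. Within \<open>C\<close> only \<open>a\<close> is
    adjacent to \<open>v\<close>, so \<open>a\<close> cuts off \<open>B \<inter> C\<close>; and
    \<open>C\<close> is joined to the outside only through \<open>v\<close> and \<open>x\<close>, so
    \<open>v\<close> cuts off \<open>B - C\<close>. As no vertex separates, both are empty.\<close>
  moreover have sub_empty: "B = {}"
    if B: "B \<subseteq> verts G - {v, a}" "between G B (verts G - {v, a} - B) = {}" "x \<notin> B" for B
  proof -
    have no_B: False if "e \<in> edges G" "ends G e = Upair y z" "y \<in> B" "z \<in> verts G - {v, a}" "z \<notin> B" for e y z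
      using B(2) that by (auto simp: between_def)
    have no_x: "z \<noteq> x" if "e \<in> edges G" "ends G e = Upair y z" "y \<in> B" for e y z
      using no_B[of e y x] that B x av by auto
    have "B \<inter> C = {} \<or> B \<inter> C = verts G - {a}"
    proof (rule closed_avoiding_vertex)
      show "between G (B \<inter> C) (verts G - insert a (B \<inter> C)) = {}"
      proof (rule ccontr)
        assume "between G (B \<inter> C) (verts G - insert a (B \<inter> C)) \<noteq> {}"
        then obtain e y z where e: "e \<in> edges G" "y \<in> B" "y \<in> C" "z \<in> verts G" "z \<noteq> a" "z \<notin> B \<inter> C"
          "ends G e = Upair y z" by (auto simp: between_def)
        have "z \<noteq> v" using to_v[OF e(1)] e B by auto
        moreover have "z \<noteq> x" using no_x[OF e(1,7,2)] .
        ultimately have "z \<in> C" using leave_C[OF e(1,7,3)] by auto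
        then show False using no_B[OF e(1,7,2)] e \<open>z \<noteq> v\<close> by auto
      qed
    qed (use B av in auto)
    then have BC: "B \<inter> C = {}" using B v av by auto
    have "B - C = {} \<or> B - C = verts G - {v}"
    proof (rule closed_avoiding_vertex)
      show "between G (B - C) (verts G - insert v (B - C)) = {}"
      proof (rule ccontr)
        assume "between G (B - C) (verts G - insert v (B - C)) \<noteq> {}"
        then obtain e y z where e: "e \<in> edges G" "y \<in> B" "y \<notin> C" "z \<in> verts G" "z \<noteq> v" "z \<notin> B - C"
          "ends G e = Upair y z" by (auto simp: between_def)
        have rev: "ends G e = Upair z y" using e(7) by auto
        have "y \<noteq> v" "y \<noteq> x" using e(2) B by auto
        then have "z \<notin> C" using leave_C[OF e(1) rev] e(3) by auto
        then show False using no_B[OF e(1,7,2)] e a BC by auto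
      qed
    qed (use B v in auto)
    then have "B - C = {}" using B x av by auto
    then show ?thesis using BC by auto
  qed
  have "B = {} \<or> B = verts G - {v, a}"
    if B: "B \<subseteq> verts G - {v, a}" "between G B (verts G - {v, a} - B) = {}" for B
  proof (cases "x \<in> B")
    case True
    have "verts G - {v, a} - (verts G - {v, a} - B) = B" using B by auto
    then have "verts G - {v, a} - B = {}"
      using B True by (intro sub_empty) (auto simp: between_commute)
    then show ?thesis using B by auto
  next
    case False
    then show ?thesis using sub_empty B by blast
  qed
  ultimately show ?thesis using that[of a] av by simp
qed

text \<open>With \<open>a\<close> chosen such that G - v - a is connected, the parity condition
  concerns only its whole vertex set. That has odd order, and as there are no loops, exactly 3 of
  the edges at \<open>v\<close> lead to it.\<close>

lemma colorable_if_simple_edge: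
  assumes "v \<in> verts G" "x \<in> verts G" "x \<noteq> v" "card (between G {v} {x}) = 1" "odd (card (verts G))"
  shows "colorable 3 1 G"
proof -
  obtain a where a: "a \<in> verts G" "a \<noteq> v" "card (between G {v} {a}) = 1"
    and closed: "\<And>D. D \<subseteq> verts G - {v, a} \<Longrightarrow> between G D (verts G - {v, a} - D) = {} \<Longrightarrow>
       D = {} \<or> D = verts G - {v, a}"
    using simple_neighbor_nonseparating[OF assms(1-4)] by blast
  obtain f where f: "between G {v} {a} = {f}" using a(3) by (auto simp: card_1_singleton_iff)
  have "card {v, a} \<le> card (verts G)"
    using finite_verts assms(1) a by (intro card_mono) auto
  then have V: "card (verts G) \<ge> 2" using a by simp
  show ?thesis
  proof (rule colorable_if_removable_pair[OF assms(1) a(1) _ f])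
    fix D assume D: "D \<subseteq> verts G - {v, a}" "between G D (verts G - {v, a} - D) = {}"
    show "even (card D) \<longleftrightarrow> even (card (between G D {v}))"
    proof (cases "D = {}")
      case True
      then show ?thesis by (simp add: between_def)
    next
      case False
      then have DZ: "D = verts G - {v, a}" using closed[OF D] by blast
      have "card D = card (verts G) - 2"
        unfolding DZ using finite_verts assms(1) a by (subst card_Diff_subset) auto
      then have "odd (card D)" using V assms(5) by simp
      moreover have "card (between G D {v}) = 3"
      proof -
        have "verts G - {v} - {a} = D" using DZ by auto
        then show ?thesis
          using card_between_split[of v "{a}"] no_loops[OF V assms(1)] assms(1) a
          by (simp add: between_commute[of G "{a}"])
      qed
      ultimately show ?thesis by simp
    qed
  qed (use a in auto)
qed

text \<open>Without loops, \<open>v\<close> has four edges to other vertices, and no neighbor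
  receives exactly one of them. So two neighbors receive two each or one neighbor receives all four.
  In the latter case \<open>v\<close> and that neighbor form the entire graph, whose order would be
  even.\<close>

lemma double_neighbors:
  assumes "odd (card (verts G))" "card (verts G) \<ge> 2" "v \<in> verts G"
    and multiple: "\<And>x. x \<in> verts G - {v} \<Longrightarrow> card (between G {x} {v}) \<noteq> 1"
  shows "\<exists>y z. y \<noteq> z \<and> {x \<in> verts G. between G {x} {v} \<noteq> {}} = {y, z} \<and> y \<noteq> v \<and> z \<noteq> v \<and>
    card (between G {y} {v}) = 2 \<and> card (between G {z} {v}) = 2"
proof -
  have loops: "card (between G {w} {w}) = 0" if "w \<in> verts G" for w
    using no_loops[OF assms(2) that] .
  have ex: "\<exists>x\<in>A. card (between G {x} {v}) \<noteq> 0" if "card (between G A {v}) \<noteq> 0" for A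
  proof -
    have "between G A {v} \<noteq> {}" using that by auto
    then obtain x where "x \<in> A" "between G {x} {v} \<noteq> {}" by (auto simp: between_def)
    then show ?thesis using finite_between[OF fin] by auto
  qed
  have "card (between G (verts G - {v}) {v}) = 4"
    using degree_split[OF assms(3)] loops[OF assms(3)] by simp
  then obtain y where y: "y \<in> verts G" "y \<noteq> v" "card (between G {y} {v}) \<noteq> 0"
    using ex[of "verts G - {v}"] by auto
  define R where "R = verts G - {v} - {y}"
  have yR: "card (between G {y} {v}) + card (between G R {v}) = 4"
    using card_between_split[of v "{y}"] assms(3) y loops[OF assms(3)] by (simp add: R_def)
  have split: "card (between G {z} {v}) + card (between G (R - {z}) {v}) = card (between G R {v})"
    if "z \<in> R" for z
  proof -
    have "{z} \<union> (R - {z}) = R" using that by auto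
    moreover have "v \<notin> {z}" "v \<notin> R - {z}" using that by (auto simp: R_def)
    ultimately show ?thesis
      using card_between_Un_left[OF fin, of "{z}" "R - {z}" v] by simp
  qed
  have "card (between G R {v}) \<noteq> 0"
  proof
    assume R0: "card (between G R {v}) = 0"
    then have vy: "card (between G {y} {v}) = 4" using yR by simp
    have "verts G - {y} - {v} = R" by (auto simp: R_def)
    then have "card (between G R {y}) = 0"
      using card_between_split[of y "{v}"] assms(3) y vy loops[OF y(1)]
      by (simp add: between_commute[of G "{v}"])
    then have "between G R {y} = {}" "between G R {v} = {}"
      using R0 finite_between[OF fin] by auto
    moreover have "between G {v, y} (verts G - {v, y}) = between G R {v} \<union> between G R {y}"
    proof -
      have "verts G - {v, y} = R" by (auto simp: R_def)
      then show ?thesis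
        using between_Un_left[of G "{v}" "{y}" R] by (simp add: between_commute[of G R] insert_commute)
    qed
    ultimately have "{v, y} = verts G"
      using closed_trivial[of "{v, y}"] assms(3) y by auto
    then have "card (verts G) = 2" using y by (metis card_2_iff)
    then show False using assms(1) by simp
  qed
  then obtain z where z: "z \<in> R" "card (between G {z} {v}) \<noteq> 0" using ex by blast
  have "card (between G {y} {v}) \<noteq> 1" "card (between G {z} {v}) \<noteq> 1"
    using multiple y z by (auto simp: R_def)
  then have two: "card (between G {y} {v}) = 2" "card (between G {z} {v}) = 2"
    "card (between G (R - {z}) {v}) = 0"
    using y z yR split[OF z(1)] by linarith+
  have "{x \<in> verts G. between G {x} {v} \<noteq> {}} = {y, z}"
  proof (intro equalityI subsetI)
    fix x assume "x \<in> {x \<in> verts G. between G {x} {v} \<noteq> {}}"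
    then have x: "x \<in> verts G" "between G {x} {v} \<noteq> {}" by auto
    have "x \<noteq> v" using x loops[OF assms(3)] finite_between[OF fin] by auto
    moreover have "x \<notin> R - {z}"
      using x(2) two(3) finite_between[OF fin, of "R - {z}" "{v}"] by (auto simp: between_def)
    ultimately show "x \<in> {y, z}" using x by (auto simp: R_def)
  next
    fix x assume "x \<in> {y, z}"
    then show "x \<in> {x \<in> verts G. between G {x} {v} \<noteq> {}}" using y z by (auto simp: R_def)
  qed
  moreover have "y \<noteq> z" "z \<noteq> v" using z by (auto simp: R_def)
  ultimately show ?thesis using two y by blast
qed

text \<open>By \<open>double_neighbors\<close> the sets of neighbors have size 2, so
  \<open>two_regular_cycle\<close> applies. No edge leaves the cycle, so by connectedness it covers
  all vertices, and each of its steps accounts for two parallel edges.\<close>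

lemma double_cycle_if_no_simple_edge:
  assumes "odd (card (verts G))" "card (verts G) \<ge> 2"
    and multiple: "\<And>v x. v \<in> verts G \<Longrightarrow> x \<in> verts G - {v} \<Longrightarrow> card (between G {x} {v}) \<noteq> 1"
  shows "double_cycle (card (verts G)) G"
proof -
  \<comment> \<open>The condition \<open>v \<in> verts G\<close> makes the symmetry of this relation
    immediate for all arguments.\<close>
  define N where "N v = {x \<in> verts G. v \<in> verts G \<and> between G {x} {v} \<noteq> {}}" for v
  have N: "N v \<subseteq> verts G \<and> card (N v) = 2 \<and> v \<notin> N v"
    and card2: "\<And>u. u \<in> N v \<Longrightarrow> card (between G {u} {v}) = 2" if v: "v \<in> verts G" for v
  proof -
    obtain y z where yz: "y \<noteq> z" "N v = {y, z}" "y \<noteq> v" "z \<noteq> v"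
      "card (between G {y} {v}) = 2" "card (between G {z} {v}) = 2"
      using double_neighbors[OF assms(1,2) v multiple[OF v]] v by (auto simp: N_def)
    have "N v \<subseteq> verts G" by (auto simp: N_def)
    then show "N v \<subseteq> verts G \<and> card (N v) = 2 \<and> v \<notin> N v" using yz by simp
    show "card (between G {u} {v}) = 2" if "u \<in> N v" for u using that yz by auto
  qed
  obtain x :: "nat \<Rightarrow> 'v" and n :: nat where n3: "n \<ge> 3" and inj: "inj_on x {..<n}" and xV: "x ` {..<n} \<subseteq> verts G"
    and cyc: "\<And>i. i < n \<Longrightarrow> \<exists>k<n. (k + 1) mod n = i \<and> N (x i) = {x k, x ((i + 1) mod n)}"
  proof (rule two_regular_cycle[of "verts G" N])
    show "finite (verts G)" by (rule finite_verts)
    show "verts G \<noteq> {}" using conn by (simp add: connected_pgraph_def)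
    show "v \<in> N u" if "u \<in> N v" for u v using that by (auto simp: N_def between_commute)
  qed (use N in auto)
  define W where "W = x ` {..<n}"
  have N_closed: "N w \<subseteq> W" if w: "w \<in> W" for w
  proof -
    obtain i where "i < n" "w = x i" using w by (auto simp: W_def)
    moreover obtain k where "k < n" "N (x i) = {x k, x ((i + 1) mod n)}" using cyc[OF \<open>i < n\<close>] by blast
    moreover have "(i + 1) mod n < n" using n3 by simp
    ultimately show ?thesis by (auto simp: W_def)
  qed
  have "between G W (verts G - W) = {}"
  proof (rule ccontr)
    assume "between G W (verts G - W) \<noteq> {}"
    then obtain e a b where e: "e \<in> edges G" "a \<in> W" "b \<in> verts G - W" "ends G e = Upair a b"
      by (auto simp: between_def)
    have "a \<in> verts G" using e(2) xV by (auto simp: W_def)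
    moreover have "e \<in> between G {b} {a}" using e by (auto simp: between_def)
    ultimately have "b \<in> N a" using e by (auto simp: N_def)
    then show False using N_closed[OF e(2)] e(3) by auto
  qed
  then have "W = {} \<or> W = verts G" using xV by (intro closed_trivial) (auto simp: W_def)
  moreover have "x 0 \<in> W" using n3 by (auto simp: W_def)
  ultimately have WV: "W = verts G" by auto
  then have bij_x: "bij_betw x {..<n} (verts G)" using inj by (auto simp: bij_betw_def W_def)
  then have card_n: "card (verts G) = n" by (metis bij_betw_same_card card_lessThan)
  define K where "K i = between G {x i} {x ((i + 1) mod n)}" for i
  have "card (K i) = 2" if "i < n" for i
  proof -
    have "x i \<in> verts G" using that xV by auto
    moreover have "x ((i + 1) mod n) \<in> N (x i)" using cyc[OF that] by auto
    ultimately show ?thesis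
      using card2 unfolding K_def by (subst between_commute) blast
  qed
  then have "\<forall>i. \<exists>p q. i < n \<longrightarrow> K i = {p, q} \<and> p \<noteq> q" by (auto simp: card_2_iff)
  then obtain p q where pq: "\<And>i. i < n \<Longrightarrow> K i = {p i, q i} \<and> p i \<noteq> q i" by metis
  define d where "d t = (if snd t then p (fst t) else q (fst t))" for t :: "nat \<times> bool"
  have dK: "d (i, b) \<in> K i" if "i < n" for i b using pq[OF that] by (auto simp: d_def)
  have K_ends: "ends G e = Upair (x i) (x ((i + 1) mod n))" "e \<in> edges G" if "e \<in> K i" for e i
    using that by (auto simp: K_def between_def)
  \<comment> \<open>A common edge of two different steps would traverse the same two vertices in
    opposite directions, as happens for \<open>n = 2\<close>; \<open>n \<ge> 3\<close> excludes
    this.\<close>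
  have K_disjoint: "i = j" if "e \<in> K i" "e \<in> K j" "i < n" "j < n" for e i j
  proof -
    have lt: "(i + 1) mod n < n" "(j + 1) mod n < n" using n3 by auto
    have x_eq: "x a = x b \<longleftrightarrow> a = b" if "a < n" "b < n" for a b
      using inj that by (auto dest: inj_onD)
    have "Upair (x i) (x ((i + 1) mod n)) = Upair (x j) (x ((j + 1) mod n))"
      using K_ends(1)[OF that(1)] K_ends(1)[OF that(2)] by (rule trans[OF sym])
    then have "i = j \<or> (i = (j + 1) mod n \<and> (i + 1) mod n = j)"
      using x_eq that(3,4) lt by (simp only: Upair_inject) blast
    then show ?thesis using n3 that(3,4) by (auto simp: mod_Suc split: if_splits)
  qed
  have "bij_betw d ({..<n} \<times> UNIV) (edges G)"
  proof (rule bij_betw_imageI)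
    show "inj_on d ({..<n} \<times> UNIV)"
    proof (rule inj_onI)
      fix s t assume st: "s \<in> {..<n} \<times> UNIV" "t \<in> {..<n} \<times> UNIV" "d s = d t"
      obtain i a j b where s: "s = (i, a)" and t: "t = (j, b)" by (cases s, cases t)
      have ij: "i < n" "j < n" "d (i, a) = d (j, b)" using st by (auto simp: s t)
      then have "d (i, a) \<in> K i" "d (i, a) \<in> K j" using dK[of i a] dK[of j b] by auto
      then have "i = j" using K_disjoint ij by blast
      moreover have "p j \<noteq> q j" using pq ij by auto
      ultimately have "a = b" using ij(3) by (auto simp: d_def split: if_splits)
      then show "s = t" using \<open>i = j\<close> by (simp add: s t)
    qed
    show "d ` ({..<n} \<times> UNIV) = edges G"
    proof (intro equalityI subsetI)
      fix e assume "e \<in> d ` ({..<n} \<times> UNIV)"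
      then obtain i b where "i < n" "e = d (i, b)" by auto
      then show "e \<in> edges G" using dK[of i b] K_ends(2) by blast
    next
      fix e assume e: "e \<in> edges G"
      obtain y z where yz: "ends G e = Upair y z" by (cases "ends G e")
      have yzV: "y \<in> verts G" "z \<in> verts G" using ends_in_verts[OF fin e yz] by auto
      then obtain i where i: "i < n" "y = x i" using bij_betw_imp_surj_on[OF bij_x] by auto
      have "e \<in> between G {z} {y}" using e yz by (auto simp: between_def)
      then have "z \<in> N (x i)" using yzV i by (auto simp: N_def)
      moreover obtain k where k: "k < n" "(k + 1) mod n = i" "N (x i) = {x k, x ((i + 1) mod n)}"
        using cyc[OF i(1)] by blast
      ultimately have "z = x k \<or> z = x ((i + 1) mod n)" by simp
      then have "\<exists>j<n. e \<in> K j"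
      proof
        assume "z = x k"
        then have "e \<in> K k" using e yz i k by (auto simp: K_def between_def)
        then show ?thesis using k by blast
      next
        assume "z = x ((i + 1) mod n)"
        then have "e \<in> K i" using e yz i by (auto simp: K_def between_def)
        then show ?thesis using i by blast
      qed
      then obtain j where j: "j < n" "e \<in> K j" by blast
      then have "e = d (j, True) \<or> e = d (j, False)" using pq[OF j(1)] by (auto simp: d_def)
      then show "e \<in> d ` ({..<n} \<times> UNIV)" using j by auto
    qed
  qed
  moreover have "\<forall>i<n. \<forall>b. ends G (d (i, b)) = Upair (x i) (x ((i + 1) mod n))"
    using dK K_ends(1) by blast
  ultimately show ?thesis
    unfolding card_n double_cycle_def using bij_x n3 by (intro conjI exI[of _ x] exI[of _ d]) auto
qed

end

text \<open>Degree 4 at the only vertex amounts to two loops. This is the case that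
  \<open>no_loops\<close> leaves aside.\<close>

lemma double_cycle_single_vertex:
  assumes "card (verts G) = 1"
  shows "double_cycle 1 G"
proof -
  obtain v where v: "verts G = {v}" using assms by (auto simp: card_1_singleton_iff)
  have "between G (verts G - {v}) {v} = {}" by (auto simp: v between_def)
  then have "card (between G {v} {v}) = 2" using degree_split[of v] v by simp
  moreover have "between G {v} {v} = edges G"
  proof (intro equalityI subsetI)
    fix e assume e: "e \<in> edges G"
    obtain y z where yz: "ends G e = Upair y z" by (cases "ends G e")
    then show "e \<in> between G {v} {v}" using ends_in_verts[OF fin e yz] e v by (auto simp: between_def)
  qed (auto simp: between_def)
  ultimately obtain p q where pq: "edges G = {p, q}" "p \<noteq> q" and loop: "between G {v} {v} = edges G"
    by (auto simp: card_2_iff)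
  define d where "d t = (if snd t then p else q)" for t :: "nat \<times> bool"
  have "bij_betw (\<lambda>_. v) {..<1::nat} (verts G)" by (auto simp: bij_betw_def v inj_on_def)
  moreover have "bij_betw d ({..<1} \<times> UNIV) (edges G)"
    using pq by (auto simp: bij_betw_def inj_on_def d_def image_iff)
  moreover have "ends G (d (i, b)) = Upair v v" for i b
  proof -
    have "d (i, b) \<in> between G {v} {v}" using loop pq by (simp add: d_def)
    then show ?thesis by (auto simp: between_def)
  qed
  ultimately show ?thesis
    unfolding double_cycle_def by (intro conjI exI[of _ "\<lambda>_. v"] exI[of _ d]) auto
qed

end

section \<open>Decomposition into odd double cycles\<close>

lemma adhesion_class_if_not_colorable:
  fixes G :: "('v, 'e) pgraph"
  assumes "quartic G" "\<not> colorable 3 1 G"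
  shows "adhesion_class G"
  using assms
proof (induction "card (verts G)" arbitrary: G rule: less_induct)
  case less
  interpret quartic G by (rule less.prems(1))
  have odd_V: "odd (card (verts G))" using colorable_if_even_order less.prems(2) by blast
  show ?case
  proof (cases "\<exists>w S. two_cut w S \<and> odd (card S)")
    case True
    then obtain w S where cut: "two_cut w S" and odd_S: "odd (card S)" by blast
    have S: "w \<in> verts G" "S \<subseteq> verts G - {w}" "between G S (verts G - insert w S) = {}"
      "card (between G S {w}) = 2"
      using cut by (auto simp: two_cut_def)
    \<comment> \<open>The other side of the adhesion. It is nonempty because its order is odd, and
      at most two edges at \<open>w\<close> are left for it, so it forms a \<open>two_cut\<close> as
      well.\<close>
    define R where "R = verts G - {w} - S"
    have finS: "finite S" and finR: "finite R"
      using S(2) finite_verts by (auto simp: R_def intro: finite_subset)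
    have "verts G = insert w (S \<union> R)" "w \<notin> S \<union> R" "S \<inter> R = {}" using S by (auto simp: R_def)
    then have card_V: "card (verts G) = Suc (card S + card R)"
      using finS finR by (simp add: card_Un_disjoint)
    have odd_R: "odd (card R)" using card_V odd_V odd_S by simp
    have cut_R: "two_cut w R"
    proof (rule two_cutI)
      have "verts G - insert w R = S" "R = verts G - insert w S" using S by (auto simp: R_def)
      then show "between G R (verts G - insert w R) = {}" using S(3) by (simp add: between_commute)
      show "R \<noteq> {}" using odd_R by auto
      show "card (between G R {w}) \<le> 3"
        using card_between_split[OF S(1,2)] S(4) by (simp add: R_def)
    qed (use S in \<open>auto simp: R_def\<close>)
    have R: "card (between G R {w}) = 2" using cut_R by (simp add: two_cut_def)
    \<comment> \<open>The two edges to each side exhaust the degree 4 of \<open>w\<close>.\<close>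
    have no_loop: "between G {w} {w} = {}"
      using card_between_split[OF S(1,2)] S(4) R finite_between[OF fin] by (simp add: R_def)
    obtain f1 f2 u1 v1 where f: "between G S {w} = {f1, f2}" "f1 \<noteq> f2"
      "ends G f1 = Upair u1 w" "ends G f2 = Upair v1 w" and uv1: "u1 \<in> S" "v1 \<in> S"
      using two_cut_edges[OF cut] by metis
    obtain f3 f4 u2 v2 where g: "between G R {w} = {f3, f4}" "f3 \<noteq> f4"
      "ends G f3 = Upair u2 w" "ends G f4 = Upair v2 w" and uv2: "u2 \<in> R" "v2 \<in> R"
      using two_cut_edges[OF cut_R] by metis
    \<comment> \<open>Each suppressed edge shares its name with one of its halves in
      \<open>G\<close>, which \<open>edge_adhesion\<close> admits.\<close>
    let ?G1 = "suppress S f1 u1 v1" and ?G2 = "suppress R f3 u2 v2"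
    note ctxt1 = cut f uv1 and ctxt2 = cut_R g uv2
    have "quartic ?G1" "quartic ?G2"
      using finite_suppress[OF ctxt1] connected_suppress[OF ctxt1] regular_suppress[OF ctxt1]
        finite_suppress[OF ctxt2] connected_suppress[OF ctxt2] regular_suppress[OF ctxt2]
      by (auto simp: quartic_def)
    moreover have "\<not> colorable 3 1 ?G1" "\<not> colorable 3 1 ?G2"
      using colorable_of_suppress[OF ctxt1 _ odd_S odd_V] colorable_of_suppress[OF ctxt2 _ odd_R odd_V]
        less.prems(2) by auto
    moreover have "card (verts ?G1) < card (verts G)" "card (verts ?G2) < card (verts G)"
      using card_V by (auto simp: suppress_def)
    ultimately have "adhesion_class ?G1" "adhesion_class ?G2"
      using less.hyps by blast+
    moreover have "edge_adhesion ?G1 f1 ?G2 f3 G"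
    proof -
      have fg_edges: "{f1, f2, f3, f4} \<subseteq> edges G"
        using f(1) g(1) between_subset_edges[of G _ "{w}"] by blast
      have fg_out: "f1 \<notin> between G S S" "f2 \<notin> between G S S" "f3 \<notin> between G S S" "f4 \<notin> between G S S"
        "f1 \<notin> between G R R" "f2 \<notin> between G R R" "f3 \<notin> between G R R" "f4 \<notin> between G R R"
        using f(3,4) g(3,4) S(2) by (auto simp: between_def R_def)
      have dist: "distinct [f1, f2, f3, f4]"
        using f g uv1 uv2 S(2) by (auto simp: R_def)
      have disjoint: "between G S S \<inter> between G R R = {}"
        by (auto simp: between_def R_def)
      have all: "edges G = between G S S \<union> between G R R \<union> {f1, f2, f3, f4}"
      proof (intro equalityI subsetI)
        fix e assume e: "e \<in> edges G"
        obtain y z where yz: "ends G e = Upair y z" by (cases "ends G e")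
        have "y \<in> verts G" "z \<in> verts G" using ends_in_verts[OF fin e yz] by auto
        then consider "y \<in> S \<or> z \<in> S" | "y \<in> R \<or> z \<in> R" | "y = w" "z = w" by (auto simp: R_def)
        then show "e \<in> between G S S \<union> between G R R \<union> {f1, f2, f3, f4}"
        proof cases
          case 1
          then show ?thesis using incident_two_cut[OF ctxt1 e] yz by auto
        next
          case 2
          then show ?thesis using incident_two_cut[OF ctxt2 e] yz by auto
        next
          case 3
          then show ?thesis using no_loop e yz by (auto simp: between_def)
        qed
      qed (use fg_edges between_subset_edges[of G S S] between_subset_edges[of G R R] in blast)
      have E1: "edges ?G1 - {f1} = between G S S" and E2: "edges ?G2 - {f3} = between G R R"
        using fg_out by (auto simp: suppress_def)
      show ?thesis
        unfolding edge_adhesion_def E1 E2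
      proof (intro conjI exI)
        show "verts ?G1 \<inter> verts ?G2 = {}" by (auto simp: suppress_def R_def)
        show "edges ?G1 \<inter> edges ?G2 = {}"
          using fg_out dist disjoint by (auto simp: suppress_def)
        show "ends ?G1 f1 = Upair u1 v1" "ends ?G2 f3 = Upair u2 v2" by (auto simp: suppress_def)
        show "w \<notin> verts ?G1 \<union> verts ?G2" using S by (auto simp: suppress_def R_def)
        show "verts G = verts ?G1 \<union> verts ?G2 \<union> {w}" using S by (auto simp: suppress_def R_def)
        show "distinct [f1, f2, f3, f4]" by (rule dist)
        show "edges G = between G S S \<union> between G R R \<union> {f1, f2, f3, f4}" by (rule all)
        show "{f1, f2, f3, f4} \<inter> (between G S S \<union> between G R R) = {}" using fg_out by blast
        show "\<forall>e\<in>between G S S. ends G e = ends ?G1 e" "\<forall>e\<in>between G R R. ends G e = ends ?G2 e"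
          using fg_out by (auto simp: suppress_def)
        show "f1 \<in> edges ?G1" "f3 \<in> edges ?G2" by (auto simp: suppress_def)
      qed (use f g in auto)
    qed
    ultimately show ?thesis by (rule adhesion_class.adhesion)
  next
    case False
    then have no_cut: "\<not> two_cut w S" for w S
      using colorable_if_even_two_cut less.prems(2) by blast
    have "card (verts G) \<noteq> 0" using odd_V by (cases "card (verts G)") auto
    show ?thesis
    proof (cases "card (verts G) = 1")
      case True
      then show ?thesis using double_cycle_single_vertex odd_double_cycle[of 1] by simp
    next
      case False
      then have "card (verts G) \<ge> 2" using \<open>card (verts G) \<noteq> 0\<close> by linarith
      moreover have "card (between G {x} {v}) \<noteq> 1" if "v \<in> verts G" "x \<in> verts G - {v}" for v x
        using colorable_if_simple_edge[OF no_cut that(1), of x] that odd_V less.prems(2)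
        by (auto simp: between_commute)
      ultimately have "double_cycle (card (verts G)) G"
        using double_cycle_if_no_simple_edge[OF no_cut odd_V] by blast
      then show ?thesis using odd_V odd_double_cycle by blast
    qed
  qed
qed

theorem theorem3:
  fixes G :: "('v, 'e) pgraph"
  assumes "finite_pgraph G" and "connected_pgraph G" and "regular_pgraph 4 G"
  shows "\<not> colorable 3 1 G \<longleftrightarrow> adhesion_class G"
proof
  assume "\<not> colorable 3 1 G"
  then show "adhesion_class G"
    using assms by (intro adhesion_class_if_not_colorable) (auto simp: quartic_def)
next
  assume "adhesion_class G"
  then show "\<not> colorable 3 1 G"
    using not_colorable_adhesion_class by (auto simp: colorable_def)
qed

end
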